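(* Let $(D,\mathbb{T})$ be a symmetric and strongly temporalisable trip network with $n$ nodes. Then there exists a schedule $S$ of $(D,\mathbb{T})$ whose $S$-reachability is at least $\frac{2}{9}n^2$ (a fraction $2/9$ of all ordered node pairs), and such a schedule can be computed in polynomial time.
   Context: A weighted multidigraph $D=(V,E)$ has a finite node set $V$ and a finite multiset $E$ of edges $(u,v,w)$ with weight $w>0$. A trip network is a pair $(D,\mathbb{T})$ where $\mathbb{T}$ is a finite multiset of walks in $D$ (trips); every node and edge of $D$ appears in some trip. The duration $\delta(T)$ of a trip is the sum of its edge weights. A temporalisation $\tau$ assigns a real starting time $\tau(T)$ to each trip. For a trip $T=e_1,\dots,e_k$ with $e_i=(u_i,v_i,w_i)$, it induces temporal edges $(u_i,v_i,\tau(T)+\sum_{j<i}w_j,w_i)$ (tail, head, starting time, travel time). The induced temporal graph $G[D,\mathbb{T},\tau]$ has node set $V$ and all temporal edges induced by all trips. A temporal path from $u$ to $v$ is a sequence of consecutive temporal edges from $u$ to $v$ in which each edge's starting time is at least the arrival time (starting time plus travel time) of the previous one; $v$ is $\tau$-reachable from $u$ if such a path exists (every node reaches itself). The $\tau$-reachability is the number of ordered pairs $(u,v)$ with $v$ $\tau$-reachable from $u$. A schedule $S$ is an ordering $T_1,\dots,T_{|\mathbb{T}|}$ of the trips; it induces the temporalisation $\tau_S(T_1)=0$, $\tau_S(T_{i+1})=\sum_{j=1}^{i}\delta(T_j)$; the $S$-reachability is the $\tau_S$-reachability. A trip network is strongly temporalisable if for every two nodes $s,t$ there exists a temporalisation $\tau$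 with $t$ $\tau$-reachable from $s$. It is symmetric if its trips can be grouped into disjoint pairs $(T,\overline{T})$ of two distinct members of $\mathbb{T}$ where $\overline{T}$ is the reverse of $T$, visiting the same nodes in reverse order. *)

theory Defs
  imports Complex_Main "HOL-Library.Multiset" "HOL-Computational_Algebra.Polynomial"
begin

section \<open>Trip networks\<close>

type_synonym 'v edge = "'v \<times> 'v \<times> real"
type_synonym 'v trip = "'v edge list"

definition tail :: "'v edge \<Rightarrow> 'v" where
  "tail e = fst e"

definition head :: "'v edge \<Rightarrow> 'v" where
  "head e = fst (snd e)"

definition weight :: "'v edge \<Rightarrow> real" where
  "weight e = snd (snd e)"

definition multidigraph :: "'v set \<Rightarrow> 'v edge multiset \<Rightarrow> bool" where
  "multidigraph V E \<longleftrightarrow>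
     finite V \<and> (\<forall>e\<in>#E. tail e \<in> V \<and> head e \<in> V \<and> weight e > 0)"

definition walk :: "'v edge multiset \<Rightarrow> 'v trip \<Rightarrow> bool" where
  "walk E T \<longleftrightarrow>
     T \<noteq> [] \<and> set T \<subseteq> set_mset E \<and>
     (\<forall>i. Suc i < length T \<longrightarrow> head (T ! i) = tail (T ! Suc i))"

definition trip_nodes :: "'v trip \<Rightarrow> 'v list" where
  "trip_nodes T = tail (hd T) # map head T"

definition trip_network :: "'v set \<Rightarrow> 'v edge multiset \<Rightarrow> 'v trip multiset \<Rightarrow> bool" where
  "trip_network V E \<T> \<longleftrightarrow>
     multidigraph V E \<and>
     (\<forall>T\<in>#\<T>. walk E T) \<and>
     (\<forall>v\<in>V. \<exists>T\<in>#\<T>. v \<in> set (trip_nodes T)) \<and>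
     (\<forall>e\<in>#E. \<exists>T\<in>#\<T>. e \<in> set T)"

definition duration :: "'v trip \<Rightarrow> real" where
  "duration T = (\<Sum>e\<leftarrow>T. weight e)"

text \<open>Equal copies of a trip are different members of the multiset of trips and may start at
  different times. Hence an assignment of starting times to the members of the multiset is a
  multiset of pairs of a trip and its starting time.\<close>

type_synonym 'v temporalisation = "('v trip \<times> real) multiset"

definition is_temporalisation :: "'v trip multiset \<Rightarrow> 'v temporalisation \<Rightarrow> bool" where
  "is_temporalisation \<T> \<tau> \<longleftrightarrow> image_mset fst \<tau> = \<T>"

text \<open>Temporal edges are quadruples (tail, head, starting time, travel time).\<close>

type_synonym 'v tedge = "'v \<times> 'v \<times> real \<times> real"

definition ttail :: "'v tedge \<Rightarrow> 'v" where
  "ttail f = fst f"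

definition thead :: "'v tedge \<Rightarrow> 'v" where
  "thead f = fst (snd f)"

definition start_time :: "'v tedge \<Rightarrow> real" where
  "start_time f = fst (snd (snd f))"

definition travel_time :: "'v tedge \<Rightarrow> real" where
  "travel_time f = snd (snd (snd f))"

definition arrival_time :: "'v tedge \<Rightarrow> real" where
  "arrival_time f = start_time f + travel_time f"

definition trip_tedges :: "'v trip \<Rightarrow> real \<Rightarrow> 'v tedge set" where
  "trip_tedges T t =
     {(tail (T ! i), head (T ! i), t + (\<Sum>j<i. weight (T ! j)), weight (T ! i)) | i. i < length T}"

definition induced_tedges :: "'v temporalisation \<Rightarrow> 'v tedge set" where
  "induced_tedges \<tau> = (\<Union>(T, t)\<in>set_mset \<tau>. trip_tedges T t)"

definition temporal_path :: "'v tedge set \<Rightarrow> 'v \<Rightarrow> 'v tedge list \<Rightarrow> 'v \<Rightarrow> bool" where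
  "temporal_path F u p v \<longleftrightarrow>
     p \<noteq> [] \<and> set p \<subseteq> F \<and> ttail (hd p) = u \<and> thead (last p) = v \<and>
     (\<forall>i. Suc i < length p \<longrightarrow>
        thead (p ! i) = ttail (p ! Suc i) \<and> arrival_time (p ! i) \<le> start_time (p ! Suc i))"

definition reachable :: "'v temporalisation \<Rightarrow> 'v \<Rightarrow> 'v \<Rightarrow> bool" where
  "reachable \<tau> u v \<longleftrightarrow> u = v \<or> (\<exists>p. temporal_path (induced_tedges \<tau>) u p v)"

definition reachability :: "'v set \<Rightarrow> 'v temporalisation \<Rightarrow> nat" where
  "reachability V \<tau> = card {(u, v). u \<in> V \<and> v \<in> V \<and> reachable \<tau> u v}"

definition is_schedule :: "'v trip multiset \<Rightarrow> 'v trip list \<Rightarrow> bool" where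
  "is_schedule \<T> S \<longleftrightarrow> mset S = \<T>"

definition schedule_temporalisation :: "'v trip list \<Rightarrow> 'v temporalisation" where
  "schedule_temporalisation S =
     mset (map (\<lambda>i. (S ! i, \<Sum>j<i. duration (S ! j))) [0..<length S])"

definition schedule_reachability :: "'v set \<Rightarrow> 'v trip list \<Rightarrow> nat" where
  "schedule_reachability V S = reachability V (schedule_temporalisation S)"

definition strongly_temporalisable :: "'v set \<Rightarrow> 'v trip multiset \<Rightarrow> bool" where
  "strongly_temporalisable V \<T> \<longleftrightarrow>
     (\<forall>s\<in>V. \<forall>t\<in>V. \<exists>\<tau>. is_temporalisation \<T> \<tau> \<and> reachable \<tau> s t)"

definition is_reverse :: "'v trip \<Rightarrow> 'v trip \<Rightarrow> bool" where
  "is_reverse T T' \<longleftrightarrow> trip_nodes T' = rev (trip_nodes T)"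

text \<open>The multiset sum makes every member of the multiset of trips belong to exactly one pair,
  so a trip that is its own reverse must still be paired with another member.\<close>

definition symmetric_trips :: "'v trip multiset \<Rightarrow> bool" where
  "symmetric_trips \<T> \<longleftrightarrow>
     (\<exists>P. image_mset fst P + image_mset snd P = \<T> \<and> (\<forall>(T, T')\<in>#P. is_reverse T T'))"


section \<open>Polynomial time\<close>

text \<open>Running time is measured in the WHILE language of N. D. Jones (Computability and Complexity
  from a Programming Perspective, MIT Press 1997): programs operate on binary trees, every
  constructor, selector, variable access, assignment and test for the empty tree costs one unit.
  There is no test for equality of trees, so trees can be shared in memory, and on inputs and
  outputs of polynomial size polynomial time in this model is polynomial time on Turing machines.\<close>

datatype bintree = Tip | Bin bintree bintree

datatype expr = EVar nat | ETip | EBin expr expr | EHd expr | ETl expr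

datatype com = Assign nat expr | Seq com com | Cond expr com com | Loop expr com

type_synonym store = "nat \<Rightarrow> bintree"

fun tree_hd :: "bintree \<Rightarrow> bintree" where
  "tree_hd Tip = Tip"
| "tree_hd (Bin a b) = a"

fun tree_tl :: "bintree \<Rightarrow> bintree" where
  "tree_tl Tip = Tip"
| "tree_tl (Bin a b) = b"

fun eval_expr :: "expr \<Rightarrow> store \<Rightarrow> bintree" where
  "eval_expr (EVar x) s = s x"
| "eval_expr ETip s = Tip"
| "eval_expr (EBin a b) s = Bin (eval_expr a s) (eval_expr b s)"
| "eval_expr (EHd a) s = tree_hd (eval_expr a s)"
| "eval_expr (ETl a) s = tree_tl (eval_expr a s)"

fun expr_time :: "expr \<Rightarrow> nat" where
  "expr_time (EVar x) = 1"
| "expr_time ETip = 1"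
| "expr_time (EBin a b) = 1 + expr_time a + expr_time b"
| "expr_time (EHd a) = 1 + expr_time a"
| "expr_time (ETl a) = 1 + expr_time a"

text \<open>\<open>exec c s t s'\<close>: started in store \<open>s\<close>, the command \<open>c\<close> halts after \<open>t\<close> units of time in
  store \<open>s'\<close>. A condition counts as true iff its value is not \<open>Tip\<close>.\<close>

inductive exec :: "com \<Rightarrow> store \<Rightarrow> nat \<Rightarrow> store \<Rightarrow> bool" where
  exec_Assign: "exec (Assign x e) s (1 + expr_time e) (s(x := eval_expr e s))"
| exec_Seq: "exec c1 s t1 s1 \<Longrightarrow> exec c2 s1 t2 s2 \<Longrightarrow> exec (Seq c1 c2) s (t1 + t2) s2"
| exec_CondT: "eval_expr e s \<noteq> Tip \<Longrightarrow> exec c1 s t s' \<Longrightarrow>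
    exec (Cond e c1 c2) s (1 + expr_time e + t) s'"
| exec_CondF: "eval_expr e s = Tip \<Longrightarrow> exec c2 s t s' \<Longrightarrow>
    exec (Cond e c1 c2) s (1 + expr_time e + t) s'"
| exec_LoopF: "eval_expr e s = Tip \<Longrightarrow> exec (Loop e c) s (1 + expr_time e) s"
| exec_LoopT: "eval_expr e s \<noteq> Tip \<Longrightarrow> exec c s t1 s1 \<Longrightarrow> exec (Loop e c) s1 t2 s2 \<Longrightarrow>
    exec (Loop e c) s (1 + expr_time e + t1 + t2) s2"

text \<open>The input is in variable 0, all other variables are initially \<open>Tip\<close>; the output is read
  off variable 0.\<close>

definition computes_within :: "com \<Rightarrow> bintree \<Rightarrow> bintree \<Rightarrow> nat \<Rightarrow> bool" where
  "computes_within c x y b \<longleftrightarrow>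
     (\<exists>t s'. exec c ((\<lambda>_. Tip)(0 := x)) t s' \<and> s' 0 = y \<and> t \<le> b)"


section \<open>Encoding of trip networks\<close>

definition enc_list :: "('a \<Rightarrow> bintree) \<Rightarrow> 'a list \<Rightarrow> bintree" where
  "enc_list f xs = foldr (\<lambda>x. Bin (f x)) xs Tip"

definition enc_bool :: "bool \<Rightarrow> bintree" where
  "enc_bool b = (if b then Bin Tip Tip else Tip)"

text \<open>Binary representation, least significant bit first.\<close>

fun enc_nat :: "nat \<Rightarrow> bintree" where
  "enc_nat n = (if n = 0 then Tip else Bin (enc_bool (odd n)) (enc_nat (n div 2)))"

declare enc_nat.simps [simp del]

text \<open>The parameter \<open>\<omega>\<close> is the encoding of the weights (for example binary fractions, if all
  weights are rational).\<close>

definition enc_edge :: "(real \<Rightarrow> bintree) \<Rightarrow> nat edge \<Rightarrow> bintree" where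
  "enc_edge \<omega> e = Bin (enc_nat (tail e)) (Bin (enc_nat (head e)) (\<omega> (weight e)))"

definition enc_trips :: "(real \<Rightarrow> bintree) \<Rightarrow> nat trip list \<Rightarrow> bintree" where
  "enc_trips \<omega> ts = enc_list (enc_list (enc_edge \<omega>)) ts"

definition enc_network ::
  "(real \<Rightarrow> bintree) \<Rightarrow> nat list \<Rightarrow> nat edge list \<Rightarrow> nat trip list \<Rightarrow> bintree" where
  "enc_network \<omega> vs es ts =
     Bin (enc_list enc_nat vs) (Bin (enc_list (enc_edge \<omega>) es) (enc_trips \<omega> ts))"

end

theory Submission
  imports Defs
begin


text \<open>Call two trips adjacent if they share a node. By symmetry every trip can be followed or
  preceded by its reverse, so the trips with a given node set, scheduled consecutively, lead from
  each of their nodes to each other one; and strong temporalisability makes the adjacency graph on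
  node sets connected. In a spanning tree of this graph there are a vertex \<open>k\<close> and a set \<open>B\<close>,
  consisting of \<open>k\<close> and some of the subtrees below it, such that \<open>B\<close> covers at least \<open>n/3\<close> nodes
  and, unless \<open>B = {k}\<close>, at most \<open>2n/3\<close>: merge leaves into their parents until a cluster covers
  \<open>n/3\<close> nodes. Schedule \<open>B\<close> towards \<open>k\<close> and then all other trips away from \<open>k\<close>. Every node
  covered by \<open>B\<close> reaches every node covered by \<open>k\<close> and the other trips, which gives at least
  \<open>2n\<^sup>2/9\<close> pairs.

  The running time is bounded by closing the polynomial-time functions under folds over lists
  whose accumulator grows by a polynomially bounded summand in each step.\<close>

section \<open>Polynomial-time functions\<close>

text \<open>The constant is 2/9 = 1/3 * 2/3. If \<open>B\<close> covers \<open>u\<close> nodes and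
  \<open>k\<close> together with the trips outside \<open>B\<close> covers \<open>w\<close>, then
  \<open>u + w \<ge> n\<close>; this is only an inequality because trips share nodes. Hence
  \<open>u * w \<ge> u * (n - u)\<close>, a concave function of \<open>u\<close> whose minimum on
  the interval from n/3 to 2n/3 is attained at both ends. If \<open>B = {k}\<close>, there is no
  upper bound on \<open>u\<close>, but then \<open>w = n\<close> and the product is at least n^2/3.

  Clusters are merged root to root only, so that removing all of a cluster except its root leaves a
  connected family. That family can then be ordered away from the root.

  A trip and its reverse have the same node set, so the order is built on one representative per
  node set, and each representative is finally replaced by its whole class.

  Closure under folds does not give unbounded search. The graph search and the merging therefore run
  for as many rounds as there are trips in the list, and counting arguments show that this
  suffices.\<close>

lemma poly_nat_mono: "m \<le> n \<Longrightarrow> poly q m \<le> poly q n" for q :: "nat poly"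
  by (induction q) (auto intro: add_mono mult_mono)

text \<open>Only variable 0 is constrained before and after the run. All other variables are
  arbitrary, so programs can be chained without tracking what earlier ones left there.\<close>

definition transforms :: "com \<Rightarrow> bintree \<Rightarrow> bintree \<Rightarrow> nat \<Rightarrow> bool" where
  "transforms c a a' b \<longleftrightarrow> (\<forall>s. s 0 = a \<longrightarrow> (\<exists>t s'. exec c s t s' \<and> s' 0 = a' \<and> t \<le> b))"

lemma transformsI:
  assumes "\<And>s. s 0 = a \<Longrightarrow> exec c s (t s) (s' s) \<and> s' s 0 = a' \<and> t s \<le> b"
  shows "transforms c a a' b"
  using assms unfolding transforms_def by blast

text \<open>Skolem form: time and final store become functions of the initial store, so the
  witnesses for a compound program can be written down explicitly.\<close>

lemma transforms_choice:
  assumes "transforms c a a' b"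
  obtains t s' where "\<And>s. s 0 = a \<Longrightarrow> exec c s (t s) (s' s) \<and> s' s 0 = a' \<and> t s \<le> b"
  using assms unfolding transforms_def by metis

lemma transforms_mono:
  assumes "transforms c a a' b" "b \<le> b'"
  shows "transforms c a a' b'"
proof -
  obtain t s' where "\<And>s. s 0 = a \<Longrightarrow> exec c s (t s) (s' s) \<and> s' s 0 = a' \<and> t s \<le> b"
    using transforms_choice[OF assms(1)] by blast
  then show ?thesis
    using assms(2) by (intro transformsI[of a c t s']) fastforce
qed

lemma transforms_Assign:
  assumes "\<And>s. s 0 = a \<Longrightarrow> eval_expr e s = a'"
  shows "transforms (Assign 0 e) a a' (1 + expr_time e)"
  by (rule transformsI[of _ _ "\<lambda>s. 1 + expr_time e" "\<lambda>s. s(0 := eval_expr e s)"])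
     (use assms exec_Assign[of 0 e] in \<open>metis fun_upd_same order_refl\<close>)

lemma transforms_Seq:
  assumes "transforms c a a' b" "transforms c' a' a'' b'"
  shows "transforms (Seq c c') a a'' (b + b')"
proof -
  obtain t f where 1: "\<And>s. s 0 = a \<Longrightarrow> exec c s (t s) (f s) \<and> f s 0 = a' \<and> t s \<le> b"
    using transforms_choice[OF assms(1)] by blast
  obtain t' f' where 2: "\<And>s. s 0 = a' \<Longrightarrow> exec c' s (t' s) (f' s) \<and> f' s 0 = a'' \<and> t' s \<le> b'"
    using transforms_choice[OF assms(2)] by blast
  show ?thesis
  proof (rule transformsI[of _ _ "\<lambda>s. t s + t' (f s)" "\<lambda>s. f' (f s)"])
    fix s :: store assume s: "s 0 = a"
    show "exec (Seq c c') s (t s + t' (f s)) (f' (f s)) \<and> f' (f s) 0 = a'' \<and>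
        t s + t' (f s) \<le> b + b'"
      using exec_Seq[of c s "t s" "f s" c' "t' (f s)" "f' (f s)"] 1 2 s by (simp add: add_mono)
  qed
qed

lemma transforms_CondT:
  assumes "\<And>s. s 0 = a \<Longrightarrow> eval_expr e s \<noteq> Tip" "transforms c a a' b"
  shows "transforms (Cond e c c') a a' (1 + expr_time e + b)"
proof -
  obtain t f where 1: "\<And>s. s 0 = a \<Longrightarrow> exec c s (t s) (f s) \<and> f s 0 = a' \<and> t s \<le> b"
    using transforms_choice[OF assms(2)] by blast
  show ?thesis
    by (rule transformsI[of _ _ "\<lambda>s. 1 + expr_time e + t s" f])
       (use 1 assms(1) in \<open>simp add: exec_CondT[simplified]\<close>)
qed

lemma transforms_CondF:
  assumes "\<And>s. s 0 = a \<Longrightarrow> eval_expr e s = Tip" "transforms c' a a' b"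
  shows "transforms (Cond e c c') a a' (1 + expr_time e + b)"
proof -
  obtain t f where 1: "\<And>s. s 0 = a \<Longrightarrow> exec c' s (t s) (f s) \<and> f s 0 = a' \<and> t s \<le> b"
    using transforms_choice[OF assms(2)] by blast
  show ?thesis
    by (rule transformsI[of _ _ "\<lambda>s. 1 + expr_time e + t s" f])
       (use 1 assms(1) in \<open>simp add: exec_CondF[simplified]\<close>)
qed

lemma transforms_LoopF:
  assumes "\<And>s. s 0 = a \<Longrightarrow> eval_expr e s = Tip"
  shows "transforms (Loop e c) a a (1 + expr_time e)"
  by (rule transformsI[of _ _ "\<lambda>s. 1 + expr_time e" "\<lambda>s. s"])
     (use assms in \<open>simp add: exec_LoopF[simplified]\<close>)

lemma transforms_LoopT:
  assumes "\<And>s. s 0 = a \<Longrightarrow> eval_expr e s \<noteq> Tip" "transforms c a a' b"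
    "transforms (Loop e c) a' a'' b'"
  shows "transforms (Loop e c) a a'' (1 + expr_time e + b + b')"
proof -
  obtain t f where 1: "\<And>s. s 0 = a \<Longrightarrow> exec c s (t s) (f s) \<and> f s 0 = a' \<and> t s \<le> b"
    using transforms_choice[OF assms(2)] by blast
  obtain t' f' where
    2: "\<And>s. s 0 = a' \<Longrightarrow> exec (Loop e c) s (t' s) (f' s) \<and> f' s 0 = a'' \<and> t' s \<le> b'"
    using transforms_choice[OF assms(3)] by blast
  show ?thesis
  proof (rule transformsI[of _ _ "\<lambda>s. 1 + expr_time e + t s + t' (f s)" "\<lambda>s. f' (f s)"])
    fix s :: store assume s: "s 0 = a"
    show "exec (Loop e c) s (1 + expr_time e + t s + t' (f s)) (f' (f s)) \<and> f' (f s) 0 = a'' \<and>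
        1 + expr_time e + t s + t' (f s) \<le> 1 + expr_time e + b + b'"
      using exec_LoopT[of e s c "t s" "f s" "t' (f s)" "f' (f s)"] assms(1) 1 2 s
      by (simp add: add_mono)
  qed
qed

text \<open>Programs use variable 0 as a stack of trees, so that a subprogram keeps everything below
  its argument.\<close>

definition runs :: "com \<Rightarrow> bintree \<Rightarrow> bintree \<Rightarrow> nat \<Rightarrow> bool" where
  "runs c x y b \<longleftrightarrow> (\<forall>r. transforms c (Bin x r) (Bin y r) b)"

text \<open>The size of the output has to be bounded separately: trees can be shared, so a program
  can build a tree of exponential size in linear time.\<close>

definition polytime :: "('a \<Rightarrow> bintree) \<Rightarrow> ('b \<Rightarrow> bintree) \<Rightarrow> ('a \<Rightarrow> 'b) \<Rightarrow> bool" where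
  "polytime ea eb f \<longleftrightarrow> (\<exists>c q. \<forall>x. runs c (ea x) (eb (f x)) (poly q (size (ea x))) \<and>
     size (eb (f x)) \<le> poly q (size (ea x)))"

definition enc_prod :: "('a \<Rightarrow> bintree) \<Rightarrow> ('b \<Rightarrow> bintree) \<Rightarrow> 'a \<times> 'b \<Rightarrow> bintree" where
  "enc_prod ea eb z = Bin (ea (fst z)) (eb (snd z))"

lemma enc_list_simps [simp]:
  "enc_list e [] = Tip" "enc_list e (x # xs) = Bin (e x) (enc_list e xs)"
  by (simp_all add: enc_list_def)

lemma size_enc_list_append [simp]:
  "size (enc_list e (xs @ ys)) = size (enc_list e xs) + size (enc_list e ys)"
  by (induction xs) auto

lemma length_le_size_enc_list: "length xs \<le> size (enc_list e xs)"
  by (induction xs) auto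

lemma size_mem_enc_list: "x \<in> set xs \<Longrightarrow> size (e x) \<le> size (enc_list e xs)"
  by (induction xs) auto

lemma polytime_assign:
  assumes "\<And>x r s. s 0 = Bin (ea x) r \<Longrightarrow> eval_expr e s = Bin (eb (f x)) r"
    and "\<And>x. size (eb (f x)) \<le> poly q (size (ea x))"
  shows "polytime ea eb f"
  unfolding polytime_def
proof (intro exI allI conjI)
  fix x
  show "runs (Assign 0 e) (ea x) (eb (f x)) (poly (q + [:1 + expr_time e:]) (size (ea x)))"
    unfolding runs_def
    by (intro allI transforms_mono[OF transforms_Assign]) (auto simp: assms(1))
  show "size (eb (f x)) \<le> poly (q + [:1 + expr_time e:]) (size (ea x))"
    using assms(2)[of x] by simp
qed

lemma polytime_cong:
  assumes "polytime ea eb f" "\<And>x. f x = g x"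
  shows "polytime ea eb g"
proof -
  have "f = g" using assms(2) by blast
  with assms(1) show ?thesis by simp
qed

text \<open>The same tree can be read as a value of another type, for example a pair of head and
  tail as a nonempty list; the identity program then suffices.\<close>

lemma polytime_recode:
  assumes "\<And>x. eb (f x) = ea x"
  shows "polytime ea eb f"
  by (rule polytime_assign[where e = "EVar 0" and q = "[:0, 1:]"]) (auto simp: assms)

lemma polytime_id: "polytime e e (\<lambda>x. x)"
  by (rule polytime_recode) simp

lemma polytime_const: "polytime ea eb (\<lambda>x. y)"
proof -
  \<comment> \<open>An expression whose value is the given tree in every store, so the result is
    produced by one assignment of constant cost.\<close>
  define lit where "lit = rec_bintree ETip (\<lambda>_ _. EBin)"
  have lit: "eval_expr (lit u) s = u" for u s
    by (induction u) (auto simp: lit_def)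
  show ?thesis
    by (rule polytime_assign[where e = "EBin (lit (eb y)) (ETl (EVar 0))" and q = "[:size (eb y):]"])
       (auto simp: lit)
qed

lemma polytime_comp:
  assumes "polytime eb ec g" "polytime ea eb f"
  shows "polytime ea ec (\<lambda>x. g (f x))"
proof -
  obtain c q where f: "\<And>x. runs c (ea x) (eb (f x)) (poly q (size (ea x)))"
    "\<And>x. size (eb (f x)) \<le> poly q (size (ea x))"
    using assms(2) unfolding polytime_def by blast
  obtain c' q' where g: "\<And>x. runs c' (eb x) (ec (g x)) (poly q' (size (eb x)))"
    "\<And>x. size (ec (g x)) \<le> poly q' (size (eb x))"
    using assms(1) unfolding polytime_def by blast
  \<comment> \<open>Here the bound on the output size is needed: the second program runs on
    \<open>eb (f x)\<close>, not on \<open>ea x\<close>.\<close>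
  have le: "poly q' (size (eb (f x))) \<le> poly q' (poly q (size (ea x)))" for x
    by (rule poly_nat_mono) (rule f(2))
  show ?thesis
    unfolding polytime_def
  proof (intro exI allI conjI)
    fix x
    show "runs (Seq c c') (ea x) (ec (g (f x))) (poly (q + pcompose q' q) (size (ea x)))"
      unfolding runs_def
    proof
      fix r
      show "transforms (Seq c c') (Bin (ea x) r) (Bin (ec (g (f x))) r)
        (poly (q + pcompose q' q) (size (ea x)))"
        by (rule transforms_mono[OF transforms_Seq[OF f(1)[unfolded runs_def, rule_format]
              g(1)[unfolded runs_def, rule_format]]]) (use le[of x] in \<open>simp add: poly_pcompose\<close>)
    qed
    show "size (ec (g (f x))) \<le> poly (q + pcompose q' q) (size (ea x))"
      using g(2)[of "f x"] le[of x] by (simp add: poly_pcompose)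
  qed
qed

lemma polytime_Pair:
  assumes "polytime ea eb f" "polytime ea ec g"
  shows "polytime ea (enc_prod eb ec) (\<lambda>x. (f x, g x))"
proof -
  obtain c q where f: "\<And>x. runs c (ea x) (eb (f x)) (poly q (size (ea x)))"
    "\<And>x. size (eb (f x)) \<le> poly q (size (ea x))"
    using assms(1) unfolding polytime_def by blast
  obtain c' q' where g: "\<And>x. runs c' (ea x) (ec (g x)) (poly q' (size (ea x)))"
    "\<And>x. size (ec (g x)) \<le> poly q' (size (ea x))"
    using assms(2) unfolding polytime_def by blast
  let ?v = "EVar 0"
  \<comment> \<open>The input is duplicated, the first result is swapped below the second copy, and
    finally the two results are joined. The 50 in \<open>?q\<close> exceeds the total cost of the
    three assignments.\<close>
  let ?dup = "EBin (EHd ?v) ?v"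
  let ?swap = "EBin (EHd (ETl ?v)) (EBin (EHd ?v) (ETl (ETl ?v)))"
  let ?cons = "EBin (EBin (EHd (ETl ?v)) (EHd ?v)) (ETl (ETl ?v))"
  let ?c = "Seq (Assign 0 ?dup) (Seq c (Seq (Assign 0 ?swap) (Seq c' (Assign 0 ?cons))))"
  let ?q = "q + q' + [:50:]"
  show ?thesis
    unfolding polytime_def
  proof (intro exI allI conjI)
    fix x
    show "runs ?c (ea x) (enc_prod eb ec (f x, g x)) (poly ?q (size (ea x)))"
      unfolding runs_def enc_prod_def
    proof
      fix r
      have 1: "transforms (Assign 0 ?dup) (Bin (ea x) r) (Bin (ea x) (Bin (ea x) r))
          (1 + expr_time ?dup)"
        by (rule transforms_Assign) simp
      have 2: "transforms (Assign 0 ?swap) (Bin (eb (f x)) (Bin (ea x) r))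
          (Bin (ea x) (Bin (eb (f x)) r)) (1 + expr_time ?swap)"
        by (rule transforms_Assign) simp
      have 3: "transforms (Assign 0 ?cons) (Bin (ec (g x)) (Bin (eb (f x)) r))
          (Bin (Bin (eb (f x)) (ec (g x))) r) (1 + expr_time ?cons)"
        by (rule transforms_Assign) simp
      show "transforms ?c (Bin (ea x) r) (Bin (Bin (eb (fst (f x, g x))) (ec (snd (f x, g x)))) r)
          (poly ?q (size (ea x)))"
        unfolding fst_conv snd_conv
        by (rule transforms_mono[OF transforms_Seq[OF 1 transforms_Seq[OF
              f(1)[unfolded runs_def, rule_format] transforms_Seq[OF 2 transforms_Seq[OF
              g(1)[unfolded runs_def, rule_format] 3]]]]]) simp
    qed
    show "size (enc_prod eb ec (f x, g x)) \<le> poly ?q (size (ea x))"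
      using f(2)[of x] g(2)[of x] by (simp add: enc_prod_def)
  qed
qed

lemma polytime_fst: "polytime ea (enc_prod eb ec) f \<Longrightarrow> polytime ea eb (\<lambda>x. fst (f x))"
  by (rule polytime_comp[of _ _ fst])
     (rule polytime_assign[where e = "EBin (EHd (EHd (EVar 0))) (ETl (EVar 0))" and q = "[:0, 1:]"],
      auto simp: enc_prod_def)

lemma polytime_snd: "polytime ea (enc_prod eb ec) f \<Longrightarrow> polytime ea ec (\<lambda>x. snd (f x))"
  by (rule polytime_comp[of _ _ snd])
     (rule polytime_assign[where e = "EBin (ETl (EHd (EVar 0))) (ETl (EVar 0))" and q = "[:0, 1:]"],
      auto simp: enc_prod_def)

lemma polytime_Cons:
  assumes "polytime ea e f" "polytime ea (enc_list e) g"
  shows "polytime ea (enc_list e) (\<lambda>x. f x # g x)"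
  using polytime_comp[OF polytime_recode[where f = "\<lambda>z. fst z # snd z"] polytime_Pair[OF assms]]
  by (simp add: enc_prod_def)

lemma polytime_tl:
  fixes e :: "'b \<Rightarrow> bintree"
  shows "polytime ea (enc_list e) f \<Longrightarrow> polytime ea (enc_list e) (\<lambda>x. tl (f x))"
proof (erule polytime_comp[rotated])
  show "polytime (enc_list e) (enc_list e) tl"
  proof (rule polytime_assign[where e = "EBin (ETl (EHd (EVar 0))) (ETl (EVar 0))" and q = "[:0, 1:]"])
    fix xs :: "'b list" and r and s :: store assume "s 0 = Bin (enc_list e xs) r"
    then show "eval_expr (EBin (ETl (EHd (EVar 0))) (ETl (EVar 0))) s = Bin (enc_list e (tl xs)) r"
      by (cases xs) auto
  next
    fix xs :: "'b list"
    show "size (enc_list e (tl xs)) \<le> poly [:0, 1:] (size (enc_list e xs))"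
      by (cases xs) auto
  qed
qed

lemma polytime_null:
  fixes e :: "'b \<Rightarrow> bintree"
  shows "polytime ea (enc_list e) f \<Longrightarrow> polytime ea enc_bool (\<lambda>x. f x = [])"
proof (erule polytime_comp[rotated])
  let ?c = "Cond (EHd (EVar 0)) (Assign 0 (EBin ETip (ETl (EVar 0))))
    (Assign 0 (EBin (EBin ETip ETip) (ETl (EVar 0))))"
  show "polytime (enc_list e) enc_bool (\<lambda>xs. xs = [])"
    unfolding polytime_def
  proof (intro exI allI conjI)
    fix xs :: "'b list"
    show "runs ?c (enc_list e xs) (enc_bool (xs = [])) (poly [:20:] (size (enc_list e xs)))"
      unfolding runs_def
      by (intro allI, cases xs)
         (rule transforms_mono[OF transforms_CondF[OF _ transforms_Assign]]
            transforms_mono[OF transforms_CondT[OF _ transforms_Assign]];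
          simp add: enc_bool_def)+
    show "size (enc_bool (xs = [])) \<le> poly [:20:] (size (enc_list e xs))"
      by (simp add: enc_bool_def)
  qed
qed

lemma polytime_if:
  assumes "polytime ea enc_bool p" "polytime ea eb f" "polytime ea eb g"
  shows "polytime ea eb (\<lambda>x. if p x then f x else g x)"
proof -
  obtain c q where f: "\<And>x. runs c (ea x) (eb (f x)) (poly q (size (ea x)))"
    "\<And>x. size (eb (f x)) \<le> poly q (size (ea x))"
    using assms(2) unfolding polytime_def by blast
  obtain c' q' where g: "\<And>x. runs c' (ea x) (eb (g x)) (poly q' (size (ea x)))"
    "\<And>x. size (eb (g x)) \<le> poly q' (size (ea x))"
    using assms(3) unfolding polytime_def by blast
  \<comment> \<open>The test is computed next to a copy of the input, which the chosen branch still
    needs.\<close>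
  have "polytime ea (enc_prod enc_bool ea) (\<lambda>x. (p x, x))"
    by (intro polytime_Pair assms polytime_id)
  then obtain c0 q0 where
    h: "\<And>x. runs c0 (ea x) (enc_prod enc_bool ea (p x, x)) (poly q0 (size (ea x)))"
    unfolding polytime_def by blast
  let ?pop = "Assign 0 (EBin (ETl (EHd (EVar 0))) (ETl (EVar 0)))"
  let ?c = "Seq c0 (Cond (EHd (EHd (EVar 0))) (Seq ?pop c) (Seq ?pop c'))"
  let ?q = "q + q' + q0 + [:20:]"
  show ?thesis
    unfolding polytime_def
  proof (intro exI allI conjI)
    fix x
    show "runs ?c (ea x) (eb (if p x then f x else g x)) (poly ?q (size (ea x)))"
      unfolding runs_def
    proof
      fix r
      have 0: "transforms c0 (Bin (ea x) r) (Bin (Bin (enc_bool (p x)) (ea x)) r) (poly q0 (size (ea x)))"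
        using h[of x] by (simp add: runs_def enc_prod_def)
      have 1: "transforms ?pop (Bin (Bin (enc_bool (p x)) (ea x)) r) (Bin (ea x) r) 8"
        by (rule transforms_mono[OF transforms_Assign]) auto
      show "transforms ?c (Bin (ea x) r) (Bin (eb (if p x then f x else g x)) r)
          (poly ?q (size (ea x)))"
      proof (cases "p x")
        case True
        have b: "transforms c (Bin (ea x) r) (Bin (eb (if p x then f x else g x)) r) (poly q (size (ea x)))"
          using f(1)[of x] by (simp add: runs_def True)
        show ?thesis
          by (rule transforms_mono[OF transforms_Seq[OF 0 transforms_CondT[OF _
                transforms_Seq[OF 1 b]]]]) (simp_all add: True enc_bool_def)
      next
        case False
        have b: "transforms c' (Bin (ea x) r) (Bin (eb (if p x then f x else g x)) r) (poly q' (size (ea x)))"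
          using g(1)[of x] by (simp add: runs_def False)
        show ?thesis
          by (rule transforms_mono[OF transforms_Seq[OF 0 transforms_CondF[OF _
                transforms_Seq[OF 1 b]]]]) (simp_all add: False enc_bool_def)
      qed
    qed
    show "size (eb (if p x then f x else g x)) \<le> poly ?q (size (ea x))"
      using f(2)[of x] g(2)[of x] by simp
  qed
qed


section \<open>Folds with an accumulator of bounded growth\<close>

text \<open>The stack holds the remaining list, the accumulator and the context \<open>x\<close>;
  \<open>pre\<close> builds the argument of the step program and \<open>post\<close> restores the
  layout. One step adds at most \<open>B\<close> to the accumulator while
  \<open>length ys * B\<close> drops by \<open>B\<close>, so \<open>M\<close> keeps bounding the
  sizes and each round costs at most \<open>poly q M + 60\<close>. Multiplicative growth would allow
  exponential accumulators.\<close>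

lemma transforms_fold_loop:
  fixes ex :: "'x \<Rightarrow> bintree" and e :: "'b \<Rightarrow> bintree" and ea :: "'a \<Rightarrow> bintree"
  defines "pre \<equiv> EBin (EBin (EHd (ETl (ETl (EVar 0)))) (EBin (EHd (EHd (EVar 0))) (EHd (ETl (EVar 0)))))
      (EBin (ETl (EHd (EVar 0))) (ETl (ETl (EVar 0))))"
    and "post \<equiv> EBin (EHd (ETl (EVar 0))) (EBin (EHd (EVar 0)) (ETl (ETl (EVar 0))))"
  assumes c: "\<And>y a. runs c (enc_prod ex (enc_prod e ea) (x, y, a)) (ea (h y a))
      (poly q (size (enc_prod ex (enc_prod e ea) (x, y, a))))"
    and growth: "\<And>y a. y \<in> set ys \<Longrightarrow> size (ea (h y a)) \<le> size (ea a) + B"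
    and M: "size (ex x) + size (enc_list e ys) + size (ea a) + length ys * B + 2 \<le> M"
  shows "transforms (Loop (EHd (EVar 0)) (Seq (Assign 0 pre) (Seq c (Assign 0 post))))
      (Bin (enc_list e ys) (Bin (ea a) (Bin (ex x) r)))
      (Bin Tip (Bin (ea (fold h ys a)) (Bin (ex x) r))) ((length ys + 1) * (poly q M + 60))"
    and "size (ea (fold h ys a)) \<le> size (ea a) + length ys * B"
  using growth M
proof (induction ys arbitrary: a)
  case Nil
  {
    case 1
    show ?case
      using transforms_mono[OF transforms_LoopF[where e = "EHd (EVar 0)"]] by simp
  next
    case 2
    show ?case by simp
  }
next
  case (Cons y ys)
  {
    case 1
    note prems = 1
    have g: "size (ea (h y a)) \<le> size (ea a) + B"
      by (rule prems) simp
    let ?r = "Bin (enc_list e ys) (Bin (ex x) r)"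
    have 1: "transforms (Assign 0 pre) (Bin (enc_list e (y # ys)) (Bin (ea a) (Bin (ex x) r)))
        (Bin (enc_prod ex (enc_prod e ea) (x, y, a)) ?r) (1 + expr_time pre)"
      by (rule transforms_Assign) (simp add: pre_def enc_prod_def)
    have 2: "transforms c (Bin (enc_prod ex (enc_prod e ea) (x, y, a)) ?r) (Bin (ea (h y a)) ?r)
        (poly q M)"
    proof (rule transforms_mono[OF c[unfolded runs_def, rule_format]], rule poly_nat_mono)
      show "size (enc_prod ex (enc_prod e ea) (x, y, a)) \<le> M"
        using prems(2) by (simp add: enc_prod_def)
    qed
    have 3: "transforms (Assign 0 post) (Bin (ea (h y a)) ?r)
        (Bin (enc_list e ys) (Bin (ea (h y a)) (Bin (ex x) r))) (1 + expr_time post)"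
      by (rule transforms_Assign) (simp add: post_def)
    have le: "size (ex x) + size (enc_list e ys) + size (ea (h y a)) + length ys * B + 2 \<le> M"
      using prems(2) g by simp
    show ?case
      unfolding fold.simps comp_def
      by (rule transforms_mono[OF transforms_LoopT[OF _ transforms_Seq[OF 1 transforms_Seq[OF 2 3]]
            Cons.IH(1)[OF prems(1) le]]])
         (auto simp: pre_def post_def)
  next
    case 2
    have g: "size (ea (h y a)) \<le> size (ea a) + B"
      by (rule 2) simp
    have le: "size (ex x) + size (enc_list e ys) + size (ea (h y a)) + length ys * B + 2 \<le> M"
      using 2(2) g by simp
    have "size (ea (fold h ys (h y a))) \<le> size (ea (h y a)) + length ys * B"
      by (rule Cons.IH(2)[OF 2(1) le]) simp
    with g show ?case by simp
  }
qed

lemma polytime_fold_aux: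
  assumes h: "polytime (enc_prod ex (enc_prod e ea)) ea (\<lambda>z. h (fst z) (fst (snd z)) (snd (snd z)))"
    and growth: "\<And>x y a. size (ea (h x y a)) \<le> size (ea a) + poly b (size (ex x) + size (e y))"
  shows "polytime (enc_prod (enc_list e) (enc_prod ea ex)) ea
    (\<lambda>z. fold (h (snd (snd z))) (fst z) (fst (snd z)))"
proof -
  obtain c q where "\<And>z. runs c (enc_prod ex (enc_prod e ea) z)
      (ea (h (fst z) (fst (snd z)) (snd (snd z)))) (poly q (size (enc_prod ex (enc_prod e ea) z)))"
    using h unfolding polytime_def by blast
  then have c: "runs c (enc_prod ex (enc_prod e ea) (x, y, a)) (ea (h x y a))
      (poly q (size (enc_prod ex (enc_prod e ea) (x, y, a))))" for x y a
    by (metis fst_conv snd_conv)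
  let ?v = "EVar 0"
  let ?unpack = "EBin (EHd (EHd ?v)) (EBin (EHd (ETl (EHd ?v))) (EBin (ETl (ETl (EHd ?v))) (ETl ?v)))"
  let ?pre = "EBin (EBin (EHd (ETl (ETl (EVar 0)))) (EBin (EHd (EHd (EVar 0))) (EHd (ETl (EVar 0)))))
      (EBin (ETl (EHd (EVar 0))) (ETl (ETl (EVar 0))))"
  let ?post = "EBin (EHd (ETl (EVar 0))) (EBin (EHd (EVar 0)) (ETl (ETl (EVar 0))))"
  let ?pop = "EBin (EHd (ETl ?v)) (ETl (ETl (ETl ?v)))"
  let ?loop = "Loop (EHd ?v) (Seq (Assign 0 ?pre) (Seq c (Assign 0 ?post)))"
  let ?c = "Seq (Assign 0 ?unpack) (Seq ?loop (Assign 0 ?pop))"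
  \<comment> \<open>The summand \<open>[:2, 1:]\<close> pays for the parts of the input,
    \<open>[:0, 1:] * b\<close> for the growth over at most \<open>n\<close> rounds;
    \<open>?t\<close> below is rounds times cost per round.\<close>
  let ?M = "[:2, 1:] + [:0, 1:] * b"
  let ?t = "[:1, 1:] * (pcompose q ?M + [:60:])"
  let ?q = "?M + ?t + [:60:]"
  show ?thesis
    unfolding polytime_def
  proof (intro exI[of _ ?c] exI[of _ ?q] allI)
    fix z :: "'b list \<times> 'c \<times> 'a"
    obtain ys a x where z: "z = (ys, a, x)" by (cases z) auto
    define n where "n = size (enc_prod (enc_list e) (enc_prod ea ex) z)"
    have n: "n = size (enc_list e ys) + size (ea a) + size (ex x) + 2"
      by (simp add: n_def z enc_prod_def)
    have len: "length ys \<le> n"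
      using length_le_size_enc_list[of ys e] n by simp
    have B: "size (ea (h x y a)) \<le> size (ea a) + poly b n" if "y \<in> set ys" for y a
    proof -
      have "poly b (size (ex x) + size (e y)) \<le> poly b n"
        using size_mem_enc_list[OF that, of e] n by (intro poly_nat_mono) simp
      then show ?thesis using growth[of x y a] by simp
    qed
    have M: "size (ex x) + size (enc_list e ys) + size (ea a) + length ys * poly b n + 2 \<le> poly ?M n"
      using n mult_right_mono[OF len, of "poly b n"] by simp
    note loop = transforms_fold_loop[where h = "h x", OF c B M]
    have loop_time: "(length ys + 1) * (poly q (poly ?M n) + 60) \<le> poly ?t n"
      using len by (simp add: poly_pcompose)
    show "runs ?c (enc_prod (enc_list e) (enc_prod ea ex) z)
        (ea (fold (h (snd (snd z))) (fst z) (fst (snd z))))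
        (poly ?q (size (enc_prod (enc_list e) (enc_prod ea ex) z))) \<and>
      size (ea (fold (h (snd (snd z))) (fst z) (fst (snd z))))
        \<le> poly ?q (size (enc_prod (enc_list e) (enc_prod ea ex) z))"
    proof
      show "runs ?c (enc_prod (enc_list e) (enc_prod ea ex) z)
        (ea (fold (h (snd (snd z))) (fst z) (fst (snd z))))
        (poly ?q (size (enc_prod (enc_list e) (enc_prod ea ex) z)))"
        unfolding runs_def n_def[symmetric]
      proof
        fix r
        let ?s = "Bin (enc_list e ys) (Bin (ea a) (Bin (ex x) r))"
        let ?s' = "Bin Tip (Bin (ea (fold (h x) ys a)) (Bin (ex x) r))"
        have 1: "transforms (Assign 0 ?unpack) (Bin (enc_prod (enc_list e) (enc_prod ea ex) z) r)
            ?s 20"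
          by (rule transforms_mono[OF transforms_Assign]) (auto simp: z enc_prod_def)
        have 2: "transforms ?loop ?s ?s' (poly ?t n)"
          by (rule transforms_mono[OF loop(1) loop_time]) auto
        have 3: "transforms (Assign 0 ?pop) ?s' (Bin (ea (fold (h x) ys a)) r) 20"
          by (rule transforms_mono[OF transforms_Assign]) auto
        have le: "20 + (poly ?t n + 20) \<le> poly ?q n"
          by simp
        show "transforms ?c (Bin (enc_prod (enc_list e) (enc_prod ea ex) z) r)
           (Bin (ea (fold (h (snd (snd z))) (fst z) (fst (snd z)))) r) (poly ?q n)"
          using transforms_mono[OF transforms_Seq[OF 1 transforms_Seq[OF 2 3]] le] z by simp
      qed
      have "size (ea (fold (h x) ys a)) \<le> poly ?M n"
        using loop(2) M by linarith
      then show "size (ea (fold (h (snd (snd z))) (fst z) (fst (snd z))))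
        \<le> poly ?q (size (enc_prod (enc_list e) (enc_prod ea ex) z))"
        unfolding n_def[symmetric] using z by simp
    qed
  qed
qed

lemma polytime_fold:
  assumes "polytime (enc_prod ex (enc_prod e ea)) ea (\<lambda>z. h (fst z) (fst (snd z)) (snd (snd z)))"
    and "\<And>x y a. size (ea (h x y a)) \<le> size (ea a) + poly b (size (ex x) + size (e y))"
    and "polytime ex (enc_list e) g" and "polytime ex ea i"
  shows "polytime ex ea (\<lambda>x. fold (h x) (g x) (i x))"
  using polytime_comp[OF polytime_fold_aux[OF assms(1,2)]
      polytime_Pair[OF assms(3) polytime_Pair[OF assms(4) polytime_id]]]
  by simp

lemma polytime_rev:
  assumes "polytime ex (enc_list e) f"
  shows "polytime ex (enc_list e) (\<lambda>x. rev (f x))"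
proof -
  have "polytime ex (enc_list e) (\<lambda>x. fold (\<lambda>y a. y # a) (f x) [])"
  proof (rule polytime_fold[where b = "[:1, 1:]"])
    show "polytime (enc_prod ex (enc_prod e (enc_list e))) (enc_list e)
        (\<lambda>z. fst (snd z) # snd (snd z))"
      by (rule polytime_id polytime_Cons polytime_fst polytime_snd)+
  qed (auto intro: polytime_const assms)
  then show ?thesis
    by (simp add: fold_Cons_rev)
qed

lemma polytime_foldr:
  assumes "polytime (enc_prod ex (enc_prod e ea)) ea (\<lambda>z. h (fst z) (fst (snd z)) (snd (snd z)))"
    and "\<And>x y a. size (ea (h x y a)) \<le> size (ea a) + poly b (size (ex x) + size (e y))"
    and "polytime ex (enc_list e) g" and "polytime ex ea i"
  shows "polytime ex ea (\<lambda>x. foldr (h x) (g x) (i x))"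
  using polytime_fold[OF assms(1,2) polytime_rev[OF assms(3)] assms(4)]
  by (simp add: foldr_conv_fold)


section \<open>Case distinction, connectives and list operations\<close>

text \<open>If \<open>l x\<close> is \<open>y # ys\<close>, the pair \<open>(x, l x)\<close> has the
  same encoding as \<open>(x, y, ys)\<close>, so the cons branch runs on it directly. In the other
  case the list is discarded to recover the input.\<close>

lemma polytime_case_list:
  assumes "polytime ex (enc_list e) l" "polytime ex eb f"
    and "polytime (enc_prod ex (enc_prod e (enc_list e))) eb
      (\<lambda>z. g (fst z) (fst (snd z)) (snd (snd z)))"
  shows "polytime ex eb (\<lambda>x. case l x of [] \<Rightarrow> f x | y # ys \<Rightarrow> g x y ys)"
proof -
  let ?e = "enc_prod ex (enc_prod e (enc_list e))"
  obtain c q where f: "\<And>x. runs c (ex x) (eb (f x)) (poly q (size (ex x)))"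
    "\<And>x. size (eb (f x)) \<le> poly q (size (ex x))"
    using assms(2) unfolding polytime_def by blast
  obtain c' q' where g': "\<And>z. runs c' (?e z) (eb (g (fst z) (fst (snd z)) (snd (snd z)))) (poly q' (size (?e z)))"
    "\<And>z. size (eb (g (fst z) (fst (snd z)) (snd (snd z)))) \<le> poly q' (size (?e z))"
    using assms(3) unfolding polytime_def by blast
  have g: "runs c' (?e (x, y, ys)) (eb (g x y ys)) (poly q' (size (?e (x, y, ys))))"
    "size (eb (g x y ys)) \<le> poly q' (size (?e (x, y, ys)))" for x y ys
    using g'[of "(x, y, ys)"] by simp_all
  obtain c0 q0 where
    h: "\<And>x. runs c0 (ex x) (enc_prod ex (enc_list e) (x, l x)) (poly q0 (size (ex x)))"
      "\<And>x. size (enc_prod ex (enc_list e) (x, l x)) \<le> poly q0 (size (ex x))"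
    using polytime_Pair[OF polytime_id assms(1)] unfolding polytime_def by blast
  let ?pop = "Assign 0 (EBin (EHd (EHd (EVar 0))) (ETl (EVar 0)))"
  let ?c = "Seq c0 (Cond (ETl (EHd (EVar 0))) c' (Seq ?pop c))"
  let ?q = "q + pcompose q' q0 + q0 + [:20:]"
  let ?F = "\<lambda>x. case l x of [] \<Rightarrow> f x | y # ys \<Rightarrow> g x y ys"
  show ?thesis
    unfolding polytime_def
  proof (intro exI[of _ ?c] exI[of _ ?q] allI)
    fix x
    have 0: "transforms c0 (Bin (ex x) r) (Bin (Bin (ex x) (enc_list e (l x))) r)
        (poly q0 (size (ex x)))" for r
      using h(1)[of x] by (simp add: runs_def enc_prod_def)
    show "runs ?c (ex x) (eb (?F x)) (poly ?q (size (ex x))) \<and>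
        size (eb (?F x)) \<le> poly ?q (size (ex x))"
    proof (cases "l x")
      case Nil
      have 1: "transforms ?pop (Bin (Bin (ex x) (enc_list e (l x))) r) (Bin (ex x) r) 8" for r
        by (rule transforms_mono[OF transforms_Assign]) auto
      have 2: "transforms c (Bin (ex x) r) (Bin (eb (?F x)) r) (poly q (size (ex x)))" for r
        using f(1)[of x] by (simp add: runs_def Nil)
      have "transforms ?c (Bin (ex x) r) (Bin (eb (?F x)) r) (poly ?q (size (ex x)))" for r
        by (rule transforms_mono[OF transforms_Seq[OF 0 transforms_CondF[OF _
              transforms_Seq[OF 1 2]]]]) (simp_all add: Nil)
      then show ?thesis
        using f(2)[of x] by (simp add: runs_def Nil)
    next
      case (Cons y ys)
      have eq: "?e (x, y, ys) = enc_prod ex (enc_list e) (x, l x)"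
        by (simp add: enc_prod_def Cons)
      have le: "poly q' (size (?e (x, y, ys))) \<le> poly q' (poly q0 (size (ex x)))"
        unfolding eq by (rule poly_nat_mono) (rule h(2))
      have 2: "transforms c' (Bin (Bin (ex x) (enc_list e (l x))) r) (Bin (eb (?F x)) r)
          (poly q' (poly q0 (size (ex x))))" for r
        using transforms_mono[OF g(1)[unfolded runs_def, rule_format] le]
        by (simp add: Cons enc_prod_def)
      have "transforms ?c (Bin (ex x) r) (Bin (eb (?F x)) r) (poly ?q (size (ex x)))" for r
        by (rule transforms_mono[OF transforms_Seq[OF 0 transforms_CondT[OF _ 2]]])
           (simp_all add: Cons poly_pcompose)
      then show ?thesis
        using order_trans[OF g(2) le] by (simp add: runs_def Cons poly_pcompose)
    qed
  qed
qed

lemmas polytime_basic =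
  polytime_id polytime_const polytime_Pair polytime_Cons polytime_if polytime_null polytime_tl
  polytime_fst polytime_snd

lemma polytime_conj:
  assumes "polytime ex enc_bool p" "polytime ex enc_bool q"
  shows "polytime ex enc_bool (\<lambda>x. p x \<and> q x)"
proof -
  have "polytime ex enc_bool (\<lambda>x. if p x then q x else False)"
    by (rule polytime_basic assms)+
  then show ?thesis by (rule polytime_cong) auto
qed

lemma polytime_not:
  assumes "polytime ex enc_bool p"
  shows "polytime ex enc_bool (\<lambda>x. \<not> p x)"
proof -
  have "polytime ex enc_bool (\<lambda>x. if p x then False else True)"
    by (rule polytime_basic assms)+
  then show ?thesis by (rule polytime_cong) auto
qed

lemma polytime_disj:
  assumes "polytime ex enc_bool p" "polytime ex enc_bool q"
  shows "polytime ex enc_bool (\<lambda>x. p x \<or> q x)"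
proof -
  have "polytime ex enc_bool (\<lambda>x. if p x then True else q x)"
    by (rule polytime_basic assms)+
  then show ?thesis by (rule polytime_cong) auto
qed

lemma polytime_eq_bool:
  assumes "polytime ex enc_bool p" "polytime ex enc_bool q"
  shows "polytime ex enc_bool (\<lambda>x. p x = q x)"
proof -
  have "polytime ex enc_bool (\<lambda>x. if p x then q x else \<not> q x)"
    by (rule polytime_basic polytime_not assms)+
  then show ?thesis by (rule polytime_cong) auto
qed

lemma polytime_skip_acc:
  assumes "polytime (enc_prod ex e) eb (\<lambda>z. f (fst z) (snd z))"
  shows "polytime (enc_prod ex (enc_prod e ea)) eb (\<lambda>z. f (fst z) (fst (snd z)))"
proof -
  have "polytime (enc_prod ex (enc_prod e ea)) (enc_prod ex e) (\<lambda>z. (fst z, fst (snd z)))"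
    by (rule polytime_basic)+
  from polytime_comp[OF assms this] show ?thesis by simp
qed

lemma polytime_bex:
  assumes "polytime (enc_prod ex e) enc_bool (\<lambda>z. P (fst z) (snd z))" "polytime ex (enc_list e) g"
  shows "polytime ex enc_bool (\<lambda>x. \<exists>y\<in>set (g x). P x y)"
proof -
  have "polytime ex enc_bool (\<lambda>x. foldr (\<lambda>y b. P x y \<or> b) (g x) False)"
  proof (rule polytime_foldr[where b = "[:1:]"])
    show "polytime (enc_prod ex (enc_prod e enc_bool)) enc_bool
        (\<lambda>z. P (fst z) (fst (snd z)) \<or> snd (snd z))"
      by (rule polytime_disj polytime_skip_acc assms polytime_basic)+
  qed (auto simp: enc_bool_def intro: assms polytime_const)
  moreover have "foldr (\<lambda>y b. P x y \<or> b) ys False = (\<exists>y\<in>set ys. P x y)" for x ys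
    by (induction ys) auto
  ultimately show ?thesis by simp
qed

lemma polytime_ball:
  assumes "polytime (enc_prod ex e) enc_bool (\<lambda>z. P (fst z) (snd z))" "polytime ex (enc_list e) g"
  shows "polytime ex enc_bool (\<lambda>x. \<forall>y\<in>set (g x). P x y)"
proof -
  have "polytime ex enc_bool (\<lambda>x. \<not> (\<exists>y\<in>set (g x). \<not> P x y))"
    by (rule polytime_not polytime_bex assms)+
  then show ?thesis by simp
qed

lemma polytime_map:
  assumes "polytime (enc_prod ex e) eb (\<lambda>z. f (fst z) (snd z))" "polytime ex (enc_list e) g"
  shows "polytime ex (enc_list eb) (\<lambda>x. map (f x) (g x))"
proof -
  obtain q where q': "\<And>z. size (eb (f (fst z) (snd z))) \<le> poly q (size (enc_prod ex e z))"
    using assms(1) unfolding polytime_def by blast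
  have q: "size (eb (f x y)) \<le> poly q (size (ex x) + size (e y) + 1)" for x y
    using q'[of "(x, y)"] by (simp add: enc_prod_def)
  have "polytime ex (enc_list eb) (\<lambda>x. foldr (\<lambda>y a. f x y # a) (g x) [])"
  proof (rule polytime_foldr[where b = "pcompose q [:1, 1:] + [:1:]"])
    show "polytime (enc_prod ex (enc_prod e (enc_list eb))) (enc_list eb)
        (\<lambda>z. f (fst z) (fst (snd z)) # snd (snd z))"
      by (rule polytime_Cons polytime_skip_acc assms polytime_basic)+
    show "size (enc_list eb (f x y # a)) \<le> size (enc_list eb a) +
        poly (pcompose q [:1, 1:] + [:1:]) (size (ex x) + size (e y))" for x y a
      using q[of x y] by (simp add: poly_pcompose)
  qed (auto intro: assms polytime_const)
  moreover have "foldr (\<lambda>y a. f x y # a) ys [] = map (f x) ys" for x ys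
    by (induction ys) auto
  ultimately show ?thesis by simp
qed

lemma polytime_filter:
  assumes "polytime (enc_prod ex e) enc_bool (\<lambda>z. P (fst z) (snd z))" "polytime ex (enc_list e) g"
  shows "polytime ex (enc_list e) (\<lambda>x. filter (P x) (g x))"
proof -
  have "polytime ex (enc_list e) (\<lambda>x. foldr (\<lambda>y a. if P x y then y # a else a) (g x) [])"
  proof (rule polytime_foldr[where b = "[:1, 1:]"])
    show "polytime (enc_prod ex (enc_prod e (enc_list e))) (enc_list e)
        (\<lambda>z. if P (fst z) (fst (snd z)) then fst (snd z) # snd (snd z) else snd (snd z))"
      by (rule polytime_if polytime_skip_acc assms polytime_basic)+
  qed (auto intro: assms polytime_const)
  moreover have "foldr (\<lambda>y a. if P x y then y # a else a) ys [] = filter (P x) ys" for x ys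
    by (induction ys) auto
  ultimately show ?thesis by simp
qed

lemma polytime_append:
  assumes "polytime ex (enc_list e) f" "polytime ex (enc_list e) g"
  shows "polytime ex (enc_list e) (\<lambda>x. f x @ g x)"
proof -
  have "polytime ex (enc_list e) (\<lambda>x. foldr (\<lambda>y a. y # a) (f x) (g x))"
  proof (rule polytime_foldr[where b = "[:1, 1:]"])
    show "polytime (enc_prod ex (enc_prod e (enc_list e))) (enc_list e)
        (\<lambda>z. fst (snd z) # snd (snd z))"
      by (rule polytime_basic)+
  qed (auto intro: assms)
  moreover have "foldr (\<lambda>y a. y # a) xs ys = xs @ ys" for xs ys :: "'b list"
    by (induction xs) auto
  ultimately show ?thesis by simp
qed

lemma polytime_concat:
  assumes "polytime ex (enc_list (enc_list e)) f"
  shows "polytime ex (enc_list e) (\<lambda>x. concat (f x))"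
proof -
  have "polytime ex (enc_list e) (\<lambda>x. foldr (\<lambda>y a. y @ a) (f x) [])"
  proof (rule polytime_foldr[where b = "[:0, 1:]"])
    show "polytime (enc_prod ex (enc_prod (enc_list e) (enc_list e))) (enc_list e)
        (\<lambda>z. fst (snd z) @ snd (snd z))"
      by (rule polytime_append polytime_basic)+
  qed (auto intro: assms polytime_const)
  then show ?thesis by (simp add: concat_conv_foldr)
qed

lemma polytime_length_le:
  assumes "polytime ex (enc_list e) f" "polytime ex (enc_list e') g"
  shows "polytime ex enc_bool (\<lambda>x. length (f x) \<le> length (g x))"
proof -
  have "polytime ex (enc_list e) (\<lambda>x. foldr (\<lambda>_ a. tl a) (g x) (f x))"
  proof (rule polytime_foldr[where b = "0"])
    show "polytime (enc_prod ex (enc_prod e' (enc_list e))) (enc_list e) (\<lambda>z. tl (snd (snd z)))"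
      by (rule polytime_basic)+
    show "size (enc_list e (tl a)) \<le> size (enc_list e a) + poly 0 (size (ex x) + size (e' y))" for x y a
      by (cases a) auto
  qed (auto intro: assms)
  moreover have "foldr (\<lambda>_ a. tl a) ys xs = drop (length ys) xs" for xs :: "'b list" and ys :: "'c list"
    by (induction ys) (auto simp: drop_Suc tl_drop)
  ultimately show ?thesis using polytime_null[of ex e "\<lambda>x. drop (length (g x)) (f x)"] by simp
qed

section \<open>Equality of bit lists and numbers\<close>

text \<open>\<open>foldr\<close> consumes \<open>xs\<close> from its end while the state consumes
  \<open>zs\<close> from its front, hence the reversal. Once \<open>zs\<close> runs out, the state
  is \<open>(False, [])\<close> and stays so.\<close>

lemma foldr_match:
  "foldr (\<lambda>x s. case snd s of [] \<Rightarrow> (False, []) | z # zs \<Rightarrow> (fst s \<and> x = z, zs)) xs (b, zs) =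
   (if length xs \<le> length zs then (b \<and> take (length xs) zs = rev xs, drop (length xs) zs)
    else (False, []))"
proof (induction xs)
  case (Cons x xs)
  show ?case
  proof (cases "length xs < length zs")
    case True
    then have "drop (length xs) zs = zs ! length xs # drop (Suc (length xs)) zs"
      by (simp add: Cons_nth_drop_Suc)
    then show ?thesis
      using Cons.IH True by (auto simp: take_Suc_conv_app_nth)
  qed (use Cons.IH in auto)
qed simp

lemma polytime_eq_bool_list:
  assumes "polytime ex (enc_list enc_bool) f" "polytime ex (enc_list enc_bool) g"
  shows "polytime ex enc_bool (\<lambda>x. f x = g x)"
proof -
  let ?h = "\<lambda>x s. case snd s of [] \<Rightarrow> (False, []) | z # zs \<Rightarrow> (fst s \<and> x = z, zs)"
  let ?e = "enc_prod enc_bool (enc_list enc_bool)"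
  have "polytime ex ?e (\<lambda>x. foldr ?h (f x) (True, rev (g x)))"
  proof (rule polytime_foldr[where b = "[:2:]"])
    show "polytime (enc_prod ex (enc_prod enc_bool ?e)) ?e
        (\<lambda>z. ?h (fst (snd z)) (snd (snd z)))"
      by (rule polytime_case_list polytime_eq_bool polytime_conj polytime_basic)+
    show "size (?e (?h y a)) \<le> size (?e a) + poly [:2:] (size (ex x) + size (enc_bool y))" for x y a
      by (cases "snd a") (auto simp: enc_prod_def enc_bool_def)
  qed (rule polytime_Pair polytime_const polytime_rev assms)+
  \<comment> \<open>The flag alone only says that \<open>f x\<close> is a suffix of
    \<open>g x\<close>; the empty rest excludes a longer \<open>g x\<close>.\<close>
  then have "polytime ex enc_bool (\<lambda>x. fst (foldr ?h (f x) (True, rev (g x))) \<and>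
      snd (foldr ?h (f x) (True, rev (g x))) = [])"
    by (intro polytime_conj polytime_null) (rule polytime_fst polytime_snd, assumption)+
  moreover have "(fst (foldr ?h xs (True, rev ys)) \<and> snd (foldr ?h xs (True, rev ys)) = []) \<longleftrightarrow> xs = ys"
    for xs ys :: "bool list"
    unfolding foldr_match by auto
  ultimately show ?thesis by simp
qed

fun bits :: "nat \<Rightarrow> bool list" where
  "bits n = (if n = 0 then [] else odd n # bits (n div 2))"

declare bits.simps [simp del]

lemma enc_nat_bits: "enc_nat n = enc_list enc_bool (bits n)"
  by (induction n rule: bits.induct) (subst enc_nat.simps, subst bits.simps, auto)

lemma bits_inject: "bits m = bits n \<longleftrightarrow> m = n"
proof (induction m arbitrary: n rule: bits.induct)
  case (1 m)
  show ?case
  proof (cases "m = 0 \<or> n = 0")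
    case True
    then show ?thesis by (auto simp: bits.simps[of m] bits.simps[of n])
  next
    case False
    have "bits m = bits n \<longleftrightarrow> odd m = odd n \<and> m div 2 = n div 2"
      using False 1 by (simp add: bits.simps[of m] bits.simps[of n])
    also have "\<dots> \<longleftrightarrow> m = n"
      by (metis odd_two_times_div_two_succ even_two_times_div_two)
    finally show ?thesis .
  qed
qed

lemma polytime_eq_nat:
  assumes "polytime ex enc_nat f" "polytime ex enc_nat g"
  shows "polytime ex enc_bool (\<lambda>x. f x = g x)"
proof -
  have *: "polytime enc_nat (enc_list enc_bool) bits"
    by (rule polytime_recode) (simp add: enc_nat_bits)
  have "polytime ex enc_bool (\<lambda>x. bits (f x) = bits (g x))"
    by (intro polytime_eq_bool_list polytime_comp[OF *] assms)
  then show ?thesis by (simp add: bits_inject)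
qed

lemma computes_within_polytime:
  assumes "polytime ea eb f"
  shows "\<exists>c q. \<forall>x. computes_within c (ea x) (eb (f x)) (poly q (size (ea x)))"
proof -
  obtain c q where c: "\<And>x. runs c (ea x) (eb (f x)) (poly q (size (ea x)))"
    using assms unfolding polytime_def by blast
  \<comment> \<open>The outer assignments create a stack whose only entry is the input and take the
    result off it at the end.\<close>
  let ?c = "Seq (Assign 0 (EBin (EVar 0) ETip)) (Seq c (Assign 0 (EHd (EVar 0))))"
  have "transforms ?c (ea x) (eb (f x)) (poly (q + [:20:]) (size (ea x)))" for x
    by (rule transforms_mono[OF transforms_Seq[OF transforms_Assign
          transforms_Seq[OF c[unfolded runs_def, rule_format] transforms_Assign]]]) auto
  then have "computes_within ?c (ea x) (eb (f x)) (poly (q + [:20:]) (size (ea x)))" for x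
    unfolding computes_within_def transforms_def by auto
  then show ?thesis by blast
qed


section \<open>Ordering the trips\<close>

definition meets :: "('a \<Rightarrow> 'v list) \<Rightarrow> 'a \<Rightarrow> 'a \<Rightarrow> bool" where
  "meets nd x y \<longleftrightarrow> (\<exists>u\<in>set (nd x). u \<in> set (nd y))"

definition same_nodes :: "('a \<Rightarrow> 'v list) \<Rightarrow> 'a \<Rightarrow> 'a \<Rightarrow> bool" where
  "same_nodes nd x y \<longleftrightarrow> set (nd x) = set (nd y)"

text \<open>On the chosen trips \<open>same_nodes\<close> is equality, so later constructions can
  identify trips by their nodes, without comparing encoded weights.\<close>

definition representatives :: "('a \<Rightarrow> 'v list) \<Rightarrow> 'a list \<Rightarrow> 'a list" where
  "representatives nd xs =
     foldr (\<lambda>x r. if \<exists>y\<in>set r. same_nodes nd x y then r else x # r) xs []"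

text \<open>One round of graph search, with \<open>same_nodes\<close> standing in for membership in
  \<open>a\<close>.\<close>

definition extend :: "('a \<Rightarrow> 'v list) \<Rightarrow> 'a list \<Rightarrow> 'a list \<Rightarrow> 'a list" where
  "extend nd xs acc =
     foldr (\<lambda>x a. if (\<exists>y\<in>set a. meets nd x y) \<and> \<not> (\<exists>y\<in>set a. same_nodes nd x y)
                then x # a else a) xs acc"

text \<open>The list \<open>xs\<close> also serves as a clock for the rounds. Elements are
  prepended, so the start \<open>k\<close> ends up last.\<close>

definition grow :: "('a \<Rightarrow> 'v list) \<Rightarrow> 'a list \<Rightarrow> 'a \<Rightarrow> 'a list" where
  "grow nd xs k = foldr (\<lambda>_ a. extend nd xs a) xs [k]"

definition covered :: "('a \<Rightarrow> 'v list) \<Rightarrow> 'v list \<Rightarrow> 'a list \<Rightarrow> 'v list" where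
  "covered nd vs C = filter (\<lambda>v. \<exists>x\<in>set C. v \<in> set (nd x)) vs"

definition large :: "('a \<Rightarrow> 'v list) \<Rightarrow> 'v list \<Rightarrow> 'a list \<Rightarrow> bool" where
  "large nd vs C \<longleftrightarrow> length vs \<le> 3 * length (covered nd vs C)"

text \<open>A cluster is a nonempty list of trips whose head is its root.\<close>

definition roots_meet :: "('a \<Rightarrow> 'v list) \<Rightarrow> 'a list \<Rightarrow> 'a list \<Rightarrow> bool" where
  "roots_meet nd C K \<longleftrightarrow>
     (case C of [] \<Rightarrow> False | c # _ \<Rightarrow> (case K of [] \<Rightarrow> False | k # _ \<Rightarrow> meets nd c k))"

text \<open>The first component of the state is the cluster still to be absorbed, or empty.\<close>

definition absorb_step ::
  "('a \<Rightarrow> 'v list) \<Rightarrow> 'a list \<Rightarrow> 'a list \<times> 'a list list \<Rightarrow> 'a list \<times> 'a list list" where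
  "absorb_step nd C s =
     (if roots_meet nd C (fst s) then ([], (C @ fst s) # snd s) else (fst s, C # snd s))"

text \<open>If no root met that of \<open>K\<close>, then \<open>K\<close> would stay in the first
  component and be lost; the anchored order of the roots rules this out.\<close>

definition absorb :: "('a \<Rightarrow> 'v list) \<Rightarrow> 'a list \<Rightarrow> 'a list list \<Rightarrow> 'a list list" where
  "absorb nd K Cs = snd (foldr (absorb_step nd) Cs (K, []))"

text \<open>The first cluster is a leaf: roots are anchored to later roots, so the rest stays
  anchored without it.\<close>

definition carve_step :: "('a \<Rightarrow> 'v list) \<Rightarrow> 'v list \<Rightarrow> 'a list list \<Rightarrow> 'a list list" where
  "carve_step nd vs Cs =
     (if \<exists>C\<in>set Cs. large nd vs C then Cs
      else case Cs of [] \<Rightarrow> [] | K # Cs' \<Rightarrow> absorb nd K Cs')"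

definition carve :: "('a \<Rightarrow> 'v list) \<Rightarrow> 'v list \<Rightarrow> 'a list \<Rightarrow> 'a list list" where
  "carve nd vs xs = (case xs of [] \<Rightarrow> []
     | k # _ \<Rightarrow> foldr (\<lambda>_ Cs. carve_step nd vs Cs) xs (map (\<lambda>x. [x]) (grow nd xs k)))"

text \<open>The root \<open>k\<close> ends \<open>rev B\<close> and also starts the reversed
  \<open>grow\<close>; \<open>tl\<close> removes this second copy.\<close>

definition order_around :: "('a \<Rightarrow> 'v list) \<Rightarrow> 'a list \<Rightarrow> 'a list \<Rightarrow> 'a list" where
  "order_around nd xs B = (case B of [] \<Rightarrow> []
     | k # _ \<Rightarrow> rev B @ tl (rev (grow nd (filter (\<lambda>x. \<forall>y\<in>set B. \<not> same_nodes nd x y) xs) k)))"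

definition trip_order :: "('a \<Rightarrow> 'v list) \<Rightarrow> 'v list \<Rightarrow> 'a list \<Rightarrow> 'a list" where
  "trip_order nd vs xs = (case filter (large nd vs) (carve nd vs xs) of [] \<Rightarrow> []
     | B # _ \<Rightarrow> order_around nd xs B)"

definition hub_schedule :: "('a \<Rightarrow> 'v list) \<Rightarrow> 'v list \<Rightarrow> 'a list \<Rightarrow> 'a list" where
  "hub_schedule nd vs xs =
     concat (map (\<lambda>r. filter (same_nodes nd r) xs) (trip_order nd vs (representatives nd xs)))"

lemma meets_sym: "meets nd x y \<longleftrightarrow> meets nd y x"
  by (auto simp: meets_def)

subsection \<open>Connected families\<close>

text \<open>Connectedness by cuts instead of paths: strong temporalisability yields a crossing pair
  for every cut, and graph search needs just such a pair to make progress.\<close>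

definition conn :: "('a \<Rightarrow> 'v list) \<Rightarrow> 'a set \<Rightarrow> bool" where
  "conn nd X \<longleftrightarrow>
     (\<forall>P\<subseteq>X. P \<noteq> {} \<longrightarrow> P \<noteq> X \<longrightarrow> (\<exists>x\<in>P. \<exists>y\<in>X - P. meets nd x y))"

text \<open>Lists are built by prepending, so connections run from an element to a later one.\<close>

fun anch :: "('a \<Rightarrow> 'v list) \<Rightarrow> 'a list \<Rightarrow> bool" where
  "anch nd [] \<longleftrightarrow> True"
| "anch nd (x # xs) \<longleftrightarrow> anch nd xs \<and> (xs = [] \<or> (\<exists>y\<in>set xs. meets nd x y))"

text \<open>A proper cut of the union must split \<open>A\<close> or \<open>B\<close>: otherwise one
  of them lies inside \<open>P\<close> and the other outside, against the common element.\<close>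

lemma conn_Un:
  assumes "conn nd A" "conn nd B" "A \<inter> B \<noteq> {}"
  shows "conn nd (A \<union> B)"
  unfolding conn_def
proof (intro allI impI)
  fix P assume P: "P \<subseteq> A \<union> B" "P \<noteq> {}" "P \<noteq> A \<union> B"
  have cut: "\<exists>x\<in>P. \<exists>y\<in>A \<union> B - P. meets nd x y"
    if "conn nd Z" "Z \<subseteq> A \<union> B" "P \<inter> Z \<noteq> {}" "\<not> Z \<subseteq> P" for Z
    using that(1)[unfolded conn_def, rule_format, of "P \<inter> Z"] that by blast
  show "\<exists>x\<in>P. \<exists>y\<in>A \<union> B - P. meets nd x y"
  proof (cases "P \<inter> A \<noteq> {} \<and> \<not> A \<subseteq> P")
    case True
    then show ?thesis using cut[OF assms(1)] by blast
  next
    case False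
    then have "P \<inter> B \<noteq> {} \<and> \<not> B \<subseteq> P"
      using P assms(3) by blast
    then show ?thesis using cut[OF assms(2)] by blast
  qed
qed

lemma conn_singleton: "conn nd {x}"
  by (auto simp: conn_def)

lemma conn_pair: "meets nd x y \<Longrightarrow> conn nd {x, y}"
  unfolding conn_def
proof (intro allI impI)
  fix P assume m: "meets nd x y" and P: "P \<subseteq> {x, y}" "P \<noteq> {}" "P \<noteq> {x, y}"
  then consider "x \<in> P" "y \<notin> P" | "y \<in> P" "x \<notin> P" by blast
  then show "\<exists>a\<in>P. \<exists>b\<in>{x, y} - P. meets nd a b"
    by cases (use m meets_sym[of nd x y] in auto)
qed

lemma conn_anch: "anch nd xs \<Longrightarrow> conn nd (set xs)"
proof (induction xs)
  case Nil
  then show ?case by (simp add: conn_def)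
next
  case (Cons x xs)
  show ?case
  proof (cases "xs = []")
    case True
    then show ?thesis by (simp add: conn_singleton)
  next
    case False
    then obtain y where y: "y \<in> set xs" "meets nd x y"
      using Cons.prems by auto
    have "conn nd ({x, y} \<union> set xs)"
      using Cons y by (intro conn_Un conn_pair) auto
    moreover have "{x, y} \<union> set xs = set (x # xs)"
      using y by auto
    ultimately show ?thesis by metis
  qed
qed

lemma conn_UNION:
  assumes "conn nd A" "\<forall>C\<in>set Cs. conn nd (set C) \<and> A \<inter> set C \<noteq> {}"
  shows "conn nd (A \<union> \<Union> (set ` set Cs))"
  using assms(2)
proof (induction Cs)
  case (Cons C Cs)
  then have "conn nd ((A \<union> \<Union> (set ` set Cs)) \<union> set C)"
    by (intro conn_Un[of nd "A \<union> \<Union> (set ` set Cs)"]) auto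
  then show ?case by (simp add: Un_ac)
qed (use assms(1) in simp)

text \<open>Inside \<open>xs\<close> only the last element may lack a later neighbour, so it alone
  has to be linked to \<open>ys\<close>.\<close>

lemma anch_append:
  assumes "anch nd xs" "anch nd ys" "ys \<noteq> []" "xs \<noteq> [] \<Longrightarrow> \<exists>y\<in>set ys. meets nd (last xs) y"
  shows "anch nd (xs @ ys)"
  using assms(1,4)
proof (induction xs)
  case (Cons x xs)
  then show ?case by (cases "xs = []") (use assms(2,3) in auto)
qed (use assms(2) in simp)

subsection \<open>Growing a connected order\<close>

lemma extend_Cons:
  "extend nd (x # xs) acc = (let a = extend nd xs acc in
     if (\<exists>y\<in>set a. meets nd x y) \<and> \<not> (\<exists>y\<in>set a. same_nodes nd x y) then x # a else a)"
  by (simp add: extend_def Let_def)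

lemma extend_invariants:
  assumes "anch nd acc" "acc \<noteq> []" "distinct acc"
  shows "anch nd (extend nd xs acc) \<and> extend nd xs acc \<noteq> [] \<and> distinct (extend nd xs acc) \<and>
    last (extend nd xs acc) = last acc \<and> set acc \<subseteq> set (extend nd xs acc) \<and>
    set (extend nd xs acc) \<subseteq> set xs \<union> set acc"
proof (induction xs)
  case Nil
  show ?case using assms by (simp add: extend_def)
next
  case (Cons x xs)
  have "x \<notin> set (extend nd xs acc)" if "\<not> (\<exists>y\<in>set (extend nd xs acc). same_nodes nd x y)"
    using that by (auto simp: same_nodes_def)
  then show ?case using Cons by (auto simp: extend_Cons Let_def)
qed

lemma extend_neighbours:
  assumes "x \<in> set xs" "y \<in> set acc" "meets nd x y"
  shows "\<exists>z\<in>set (extend nd xs acc). same_nodes nd x z"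
  using assms(1)
proof (induction xs)
  case (Cons x' xs)
  have mono: "set acc \<subseteq> set (extend nd xs acc)"
    by (induction xs) (auto simp: extend_def)
  show ?case
  proof (cases "x = x'")
    case True
    then show ?thesis
      using mono assms(2,3) by (auto simp: extend_Cons Let_def same_nodes_def)
  next
    case False
    then show ?thesis using Cons by (auto simp: extend_Cons Let_def)
  qed
qed simp

lemma grow_spec:
  assumes conn: "conn nd (insert k (set xs))" and inj: "inj_on (\<lambda>x. set (nd x)) (insert k (set xs))"
  shows "anch nd (grow nd xs k)" "distinct (grow nd xs k)" "grow nd xs k \<noteq> []"
    "last (grow nd xs k) = k" "set (grow nd xs k) = insert k (set xs)"
proof -
  define X where "X = insert k (set xs)"
  define G where "G zs = foldr (\<lambda>_ a. extend nd xs a) zs [k]" for zs :: "'a list"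
  \<comment> \<open>Progress measure: until all of \<open>X\<close> is reached, there are more
    elements than rounds. After \<open>length xs\<close> rounds there are at least
    \<open>Suc (length xs)\<close> elements, and \<open>X\<close> has no more than that.\<close>
  have G: "anch nd (G zs) \<and> distinct (G zs) \<and> G zs \<noteq> [] \<and> last (G zs) = k \<and> set (G zs) \<subseteq> X \<and>
    (set (G zs) = X \<or> length zs < card (set (G zs)))" for zs
  proof (induction zs)
    case Nil
    then show ?case by (simp add: G_def X_def)
  next
    case (Cons z zs)
    define a where "a = G zs"
    have Ga: "G (z # zs) = extend nd xs a"
      by (simp add: G_def a_def)
    have a: "anch nd a" "distinct a" "a \<noteq> []" "last a = k" "set a \<subseteq> X"
      "set a = X \<or> length zs < card (set a)"
      using Cons by (simp_all add: a_def)
    note ext = extend_invariants[OF a(1,3,2), of xs]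
    have sub: "set (extend nd xs a) \<subseteq> X"
      using ext a(5) by (auto simp: X_def)
    have "set (extend nd xs a) = X \<or> length (z # zs) < card (set (extend nd xs a))"
    proof (cases "set a = X")
      case True
      then show ?thesis using ext sub by blast
    next
      case False
      then obtain y x where xy: "y \<in> set a" "x \<in> X - set a" "meets nd y x"
        using conn[folded X_def, unfolded conn_def, rule_format, OF a(5)] a(3) by auto
      have "k \<in> set a" using a(3,4) last_in_set by metis
      then have "x \<in> set xs" using xy(2) by (auto simp: X_def)
      then obtain z' where z': "z' \<in> set (extend nd xs a)" "same_nodes nd x z'"
        using extend_neighbours[OF _ xy(1)] xy(3) meets_sym by metis
      \<comment> \<open>\<open>extend\<close> only guarantees an element with the node set of
        \<open>x\<close>; injectivity turns it into \<open>x\<close> itself, so the round has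
        enlarged the set.\<close>
      have "x = z'"
        using inj[folded X_def, THEN inj_onD, of x z'] z' sub xy(2) by (auto simp: same_nodes_def)
      then have "set a \<subset> set (extend nd xs a)"
        using z'(1) xy(2) ext by blast
      then have "card (set a) < card (set (extend nd xs a))"
        by (intro psubset_card_mono) auto
      then show ?thesis using a(6) False by simp
    qed
    then show ?case
      unfolding Ga using ext sub a(4) by simp
  qed
  have "card X \<le> Suc (length xs)"
    using card_length[of xs] by (simp add: X_def card_insert_if)
  moreover have "card (set (G xs)) \<le> card X" if "set (G xs) \<subseteq> X"
    using that by (intro card_mono) (auto simp: X_def)
  ultimately have "set (G xs) = X"
    using G[of xs] card_subset_eq[of X "set (G xs)"] by (auto simp: X_def)
  moreover have "grow nd xs k = G xs"
    by (simp add: grow_def G_def)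
  ultimately show "anch nd (grow nd xs k)" "distinct (grow nd xs k)" "grow nd xs k \<noteq> []"
    "last (grow nd xs k) = k" "set (grow nd xs k) = insert k (set xs)"
    using G[of xs] by (simp_all add: X_def)
qed

subsection \<open>Carving out a cluster\<close>

text \<open>After a merge the first component is empty and \<open>roots_meet\<close> is false, so
  the clusters still to come are copied and only one cluster absorbs \<open>K\<close>.\<close>

lemma foldr_absorb:
  assumes "K \<noteq> []" "\<forall>C\<in>set Cs. C \<noteq> []"
  shows "foldr (absorb_step nd) Cs (K, []) = (K, Cs) \<and> (\<forall>C\<in>set Cs. \<not> meets nd (hd C) (hd K)) \<or>
    (\<exists>Cs1 C Cs2. Cs = Cs1 @ C # Cs2 \<and> meets nd (hd C) (hd K) \<and>
       foldr (absorb_step nd) Cs (K, []) = ([], Cs1 @ (C @ K) # Cs2))"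
  using assms(2)
proof (induction Cs)
  case (Cons C Cs)
  have rm: "roots_meet nd C K \<longleftrightarrow> meets nd (hd C) (hd K)"
    using assms(1) Cons.prems by (auto simp: roots_meet_def split: list.splits)
  consider "foldr (absorb_step nd) Cs (K, []) = (K, Cs)" "\<forall>C\<in>set Cs. \<not> meets nd (hd C) (hd K)"
    | Cs1 C' Cs2 where "Cs = Cs1 @ C' # Cs2" "meets nd (hd C') (hd K)"
       "foldr (absorb_step nd) Cs (K, []) = ([], Cs1 @ (C' @ K) # Cs2)"
    using Cons by auto
  then show ?case
  proof cases
    case 1
    show ?thesis
    proof (cases "meets nd (hd C) (hd K)")
      case True
      then have "foldr (absorb_step nd) (C # Cs) (K, []) = ([], [] @ (C @ K) # Cs)"
        using 1 rm by (simp add: absorb_step_def[of nd C])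
      then show ?thesis using True by blast
    next
      case False
      then show ?thesis using 1 rm by (simp add: absorb_step_def[of nd C])
    qed
  next
    case 2
    have "foldr (absorb_step nd) (C # Cs) (K, []) = ([], (C # Cs1) @ (C' @ K) # Cs2)"
      using 2(3) by (auto simp: absorb_step_def[of nd C] roots_meet_def split: list.splits)
    moreover have "C # Cs = (C # Cs1) @ C' # Cs2"
      using 2(1) by simp
    ultimately show ?thesis using 2(2) by blast
  qed
qed simp

lemma absorb_cases:
  assumes "K \<noteq> []" "\<forall>C\<in>set Cs. C \<noteq> []" "\<exists>C\<in>set Cs. meets nd (hd C) (hd K)"
  obtains Cs1 C Cs2 where "Cs = Cs1 @ C # Cs2" "meets nd (hd C) (hd K)"
    "absorb nd K Cs = Cs1 @ (C @ K) # Cs2"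
  using foldr_absorb[OF assms(1,2), of nd] assms(3) unfolding absorb_def by auto

text \<open>Each \<open>rev C\<close> is anchored towards the root \<open>hd C\<close>. The size
  condition is the upper bound 2n/3, from which only single trips are exempt.\<close>

definition clusters :: "('a \<Rightarrow> 'v list) \<Rightarrow> 'v list \<Rightarrow> 'a list list \<Rightarrow> bool" where
  "clusters nd vs Cs \<longleftrightarrow> anch nd (map hd Cs) \<and> distinct (concat Cs) \<and>
     (\<forall>C\<in>set Cs. C \<noteq> [] \<and> anch nd (rev C) \<and>
        (length C = 1 \<or> 3 * length (covered nd vs C) \<le> 2 * length vs))"

lemma length_covered_append:
  "length (covered nd vs (C @ K)) \<le> length (covered nd vs C) + length (covered nd vs K)"
  unfolding covered_def by (induction vs) auto

lemma carve_step_spec: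
  assumes cl: "clusters nd vs Cs" and small: "\<not> (\<exists>C\<in>set Cs. large nd vs C)"
    and all: "\<forall>v\<in>set vs. \<exists>x\<in>set (concat Cs). v \<in> set (nd x)" and ne: "concat Cs \<noteq> []"
  shows "clusters nd vs (carve_step nd vs Cs)" "set (concat (carve_step nd vs Cs)) = set (concat Cs)"
    "length (carve_step nd vs Cs) < length Cs"
proof -
  obtain K Cs' where Cs: "Cs = K # Cs'"
    using ne by (cases Cs) auto
  \<comment> \<open>A single remaining cluster would cover all of \<open>vs\<close> and thus be
    large.\<close>
  have "Cs' \<noteq> []"
  proof
    assume "Cs' = []"
    then have "covered nd vs K = vs"
      using all Cs by (simp add: covered_def)
    then show False using small Cs by (simp add: large_def)
  qed
  then have "\<exists>C\<in>set Cs'. meets nd (hd K) (hd C)"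
    using cl Cs by (simp add: clusters_def)
  then have met: "\<exists>C\<in>set Cs'. meets nd (hd C) (hd K)"
    using meets_sym by metis
  have ne': "K \<noteq> []" "\<forall>C\<in>set Cs'. C \<noteq> []"
    using cl Cs by (auto simp: clusters_def)
  obtain Cs1 C Cs2 where s: "Cs' = Cs1 @ C # Cs2" "meets nd (hd C) (hd K)"
    "absorb nd K Cs' = Cs1 @ (C @ K) # Cs2"
    by (rule absorb_cases[OF ne' met])
  have step: "carve_step nd vs Cs = Cs1 @ (C @ K) # Cs2"
    using small s(3) Cs by (simp add: carve_step_def)
  have C: "C \<noteq> []" "K \<noteq> []" "anch nd (rev C)" "anch nd (rev K)"
    using cl Cs s(1) by (auto simp: clusters_def)
  have old: "D \<noteq> [] \<and> anch nd (rev D) \<and>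
      (length D = 1 \<or> 3 * length (covered nd vs D) \<le> 2 * length vs)" if "D \<in> set Cs1 \<union> set Cs2" for D
    using cl that by (auto simp: clusters_def Cs s(1))
  \<comment> \<open>The merged cluster keeps the root of \<open>C\<close>: read in reverse it runs
    through \<open>K\<close> to the root of \<open>K\<close>, which meets the root of
    \<open>C\<close>.\<close>
  have "anch nd (rev K @ rev C)"
  proof (rule anch_append)
    show "\<exists>y\<in>set (rev C). meets nd (last (rev K)) y"
      using C(1,2) s(2) meets_sym by (metis hd_in_set last_rev set_rev)
  qed (use C in simp_all)
  \<comment> \<open>Neither cluster is large, so each covers less than n/3 nodes and both together
    less than 2n/3.\<close>
  moreover have "3 * length (covered nd vs (C @ K)) \<le> 2 * length vs"
  proof -
    have "\<not> large nd vs C" "\<not> large nd vs K"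
      using small Cs s(1) by simp_all
    then show ?thesis
      using length_covered_append[of nd vs C K] by (simp add: large_def)
  qed
  ultimately have new: "C @ K \<noteq> [] \<and> anch nd (rev (C @ K)) \<and>
      (length (C @ K) = 1 \<or> 3 * length (covered nd vs (C @ K)) \<le> 2 * length vs)"
    using C(1) by simp
  have "anch nd (map hd Cs')"
    using cl by (simp add: clusters_def Cs)
  then have "anch nd (map hd (Cs1 @ (C @ K) # Cs2))"
    using C(1) s(1) by simp
  moreover have "distinct (concat (Cs1 @ (C @ K) # Cs2))"
  proof -
    have "distinct (K @ concat Cs1 @ C @ concat Cs2)"
      using cl by (simp add: clusters_def Cs s(1))
    then show ?thesis
      unfolding concat.simps concat_append distinct_append set_append by blast
  qed
  ultimately show "clusters nd vs (carve_step nd vs Cs)"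
    unfolding step clusters_def
  proof (intro conjI)
    show "\<forall>D\<in>set (Cs1 @ (C @ K) # Cs2). D \<noteq> [] \<and> anch nd (rev D) \<and>
        (length D = 1 \<or> 3 * length (covered nd vs D) \<le> 2 * length vs)"
    proof
      fix D assume "D \<in> set (Cs1 @ (C @ K) # Cs2)"
      then consider "D \<in> set Cs1 \<union> set Cs2" | "D = C @ K" by auto
      then show "D \<noteq> [] \<and> anch nd (rev D) \<and>
          (length D = 1 \<or> 3 * length (covered nd vs D) \<le> 2 * length vs)"
        using old new by cases simp_all
    qed
  qed
  show "set (concat (carve_step nd vs Cs)) = set (concat Cs)"
    unfolding step unfolding Cs s(1) by auto
  show "length (carve_step nd vs Cs) < length Cs"
    unfolding step unfolding Cs s(1) by simp
qed

lemma carve_spec: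
  assumes xs: "xs \<noteq> []" and conn: "conn nd (set xs)" and inj: "inj_on (\<lambda>x. set (nd x)) (set xs)"
    and all: "\<forall>v\<in>set vs. \<exists>x\<in>set xs. v \<in> set (nd x)"
  shows "clusters nd vs (carve nd vs xs)" "set (concat (carve nd vs xs)) = set xs"
    "\<exists>C\<in>set (carve nd vs xs). large nd vs C"
proof -
  obtain k ks where ks: "xs = k # ks" using xs by (cases xs) auto
  have ins: "insert k (set xs) = set xs" using ks by auto
  note g = grow_spec[of nd k xs, unfolded ins, OF conn inj]
  define Cs0 where "Cs0 = map (\<lambda>x. [x]) (grow nd xs k)"
  define Cs where "Cs zs = foldr (\<lambda>_ Cs. carve_step nd vs Cs) zs Cs0" for zs :: "'a list"
  have conc: "concat (map (\<lambda>x. [x]) ys) = ys" for ys :: "'a list"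
    by (induction ys) auto
  have "map hd Cs0 = grow nd xs k"
    by (simp add: Cs0_def comp_def)
  then have cl0: "clusters nd vs Cs0"
    unfolding clusters_def using g(1,2) by (auto simp: Cs0_def conc)
  have set0: "set (concat Cs0) = set xs"
    unfolding Cs0_def conc by (rule g(5))
  have "length Cs0 = card (set xs)"
    using g(2,5) by (simp add: Cs0_def distinct_card[symmetric])
  then have len0: "length Cs0 \<le> length xs"
    by (simp add: card_length)
  \<comment> \<open>Each round without a large cluster removes one cluster, so
    \<open>length xs\<close> such rounds would leave none, although the clusters still contain all
    of \<open>xs\<close>.\<close>
  have *: "clusters nd vs (Cs zs) \<and> set (concat (Cs zs)) = set xs \<and>
    ((\<exists>C\<in>set (Cs zs). large nd vs C) \<or> length (Cs zs) + length zs \<le> length Cs0)" for zs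
  proof (induction zs)
    case Nil
    then show ?case using cl0 set0 by (simp add: Cs_def)
  next
    case (Cons z zs)
    have Cz: "Cs (z # zs) = carve_step nd vs (Cs zs)"
      by (simp add: Cs_def)
    show ?case
    proof (cases "\<exists>C\<in>set (Cs zs). large nd vs C")
      case True
      then have "Cs (z # zs) = Cs zs" unfolding Cz by (simp add: carve_step_def)
      then show ?thesis using Cons True by simp
    next
      case False
      have set: "set (concat (Cs zs)) = set xs" using Cons by simp
      have "concat (Cs zs) \<noteq> []" using set xs by (metis set_empty)
      note st = carve_step_spec[OF conjunct1[OF Cons.IH] False all[folded set] this, folded Cz, unfolded set]
      have "length (Cs zs) + length zs \<le> length Cs0"
        using Cons False by blast
      then show ?thesis
        using st by (intro conjI disjI2) simp_all
    qed
  qed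
  have carve: "carve nd vs xs = Cs xs"
    unfolding carve_def Cs_def Cs0_def by (subst (1) ks) simp
  show "clusters nd vs (carve nd vs xs)" "set (concat (carve nd vs xs)) = set xs"
    using *[of xs] unfolding carve by simp_all
  show "\<exists>C\<in>set (carve nd vs xs). large nd vs C"
  proof (rule ccontr)
    assume "\<not> ?thesis"
    then have "length (Cs xs) + length xs \<le> length xs" using *[of xs] len0 unfolding carve by linarith
    then have "Cs xs = []" by simp
    then show False using *[of xs] xs by simp
  qed
qed

text \<open>The roots alone are connected, and every other cluster is connected and contains its
  root. Hence \<open>B\<close> can lose everything except its root.\<close>

lemma conn_complement_cluster:
  assumes cl: "clusters nd vs Cs" and B: "B \<in> set Cs"
  shows "conn nd (insert (hd B) (set (concat Cs) - set B))"
proof -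
  obtain Cs1 Cs2 where Cs: "Cs = Cs1 @ B # Cs2"
    using B by (meson split_list)
  define R where "R = set (concat (Cs1 @ Cs2))"
  have C: "C \<noteq> []" "anch nd (rev C)" if "C \<in> set Cs" for C
    using cl that by (simp_all add: clusters_def)
  have "conn nd (set (map hd Cs) \<union> \<Union> (set ` set (Cs1 @ Cs2)))"
  proof (rule conn_UNION)
    show "conn nd (set (map hd Cs))"
      using cl by (intro conn_anch) (simp add: clusters_def)
    show "\<forall>C\<in>set (Cs1 @ Cs2). conn nd (set C) \<and> set (map hd Cs) \<inter> set C \<noteq> {}"
    proof (intro ballI conjI)
      fix C assume "C \<in> set (Cs1 @ Cs2)"
      then have CCs: "C \<in> set Cs" by (simp add: Cs disj_imp)
      show "conn nd (set C)"
        using conn_anch[OF C(2)[OF CCs]] by simp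
      have "hd C \<in> set (map hd Cs)" "hd C \<in> set C"
        using CCs C(1)[OF CCs] by simp_all
      then show "set (map hd Cs) \<inter> set C \<noteq> {}" by blast
    qed
  qed
  moreover have "\<Union> (set ` set (Cs1 @ Cs2)) = R"
    by (simp add: R_def)
  moreover have "set (map hd Cs) \<union> R = insert (hd B) R"
  proof -
    have "hd C \<in> R" if "C \<in> set (Cs1 @ Cs2)" for C
    proof -
      have "C \<in> set Cs" using that by (simp add: Cs disj_imp)
      from C(1)[OF this] that show ?thesis
        unfolding R_def set_concat by (meson UN_I hd_in_set)
    qed
    then have "hd ` set (Cs1 @ Cs2) \<subseteq> R" by blast
    moreover have "set (map hd Cs) = insert (hd B) (hd ` set (Cs1 @ Cs2))"
      by (simp add: Cs image_Un)
    ultimately show ?thesis by blast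
  qed
  moreover have "R = set (concat Cs) - set B"
  proof -
    have "distinct (concat Cs1 @ B @ concat Cs2)"
      using cl by (simp add: clusters_def Cs)
    then have "set (concat Cs1) \<inter> set B = {}" "set (concat Cs2) \<inter> set B = {}"
      unfolding distinct_append set_append by blast+
    moreover have "set (concat Cs) = set (concat Cs1) \<union> set B \<union> set (concat Cs2)"
      "R = set (concat Cs1) \<union> set (concat Cs2)"
      unfolding R_def Cs concat.simps concat_append set_append by blast+
    ultimately show ?thesis by blast
  qed
  ultimately show ?thesis by simp
qed

subsection \<open>Pairs connected by an order\<close>

text \<open>Idealised journeys: each entry is used at most once, in list order, and leads from any
  of its nodes to any other. Symmetry makes this true of whole classes of trips.\<close>

fun connects :: "('a \<Rightarrow> 'v list) \<Rightarrow> 'a list \<Rightarrow> 'v \<Rightarrow> 'v \<Rightarrow> bool" where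
  "connects nd [] u v \<longleftrightarrow> u = v"
| "connects nd (x # xs) u v \<longleftrightarrow>
     connects nd xs u v \<or> u \<in> set (nd x) \<and> (\<exists>w\<in>set (nd x). connects nd xs w v)"

lemma connects_append: "connects nd xs u w \<Longrightarrow> connects nd ys w v \<Longrightarrow> connects nd (xs @ ys) u v"
  by (induction xs arbitrary: u) auto

lemma connects_refl: "connects nd xs u u"
  by (induction xs) auto

lemma connects_rev: "connects nd xs u v \<Longrightarrow> connects nd (rev xs) v u"
proof (induction xs arbitrary: u)
  case (Cons x xs)
  from Cons.prems consider "connects nd xs u v"
    | w where "u \<in> set (nd x)" "w \<in> set (nd x)" "connects nd xs w v"
    by auto
  then show ?case
  proof cases
    case 1
    then show ?thesis
      using connects_append[OF Cons.IH[OF 1] connects_refl] by simp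
  next
    case 2
    then have "connects nd [x] w u" by auto
    then show ?thesis
      using connects_append[OF Cons.IH[OF 2(3)]] by simp
  qed
qed simp

text \<open>Every element hands over to a later one through a shared node until the last is
  reached.\<close>

lemma connects_to_last:
  assumes "anch nd xs" "x \<in> set xs" "u \<in> set (nd x)" "v \<in> set (nd (last xs))"
  shows "connects nd xs u v"
  using assms
proof (induction xs arbitrary: x u)
  case (Cons z xs)
  show ?case
  proof (cases "xs = []")
    case True
    then show ?thesis using Cons.prems by auto
  next
    case False
    then have v: "v \<in> set (nd (last xs))" using Cons.prems by simp
    show ?thesis
    proof (cases "x = z")
      case True
      obtain y w where "y \<in> set xs" "w \<in> set (nd z)" "w \<in> set (nd y)"
        using Cons.prems(1) False by (auto simp: meets_def)
      then have "connects nd xs w v"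
        using Cons.IH[of y w] Cons.prems(1) v by simp
      then show ?thesis using True Cons.prems(3) \<open>w \<in> set (nd z)\<close> by auto
    next
      case x: False
      then show ?thesis using Cons.IH[of x u] Cons.prems v by simp
    qed
  qed
qed simp

lemma order_around_spec:
  assumes cl: "clusters nd vs Cs" and B: "B \<in> set Cs" and set: "set (concat Cs) = set xs"
    and inj: "inj_on (\<lambda>x. set (nd x)) (set xs)" and nonempty: "\<And>x. x \<in> set xs \<Longrightarrow> nd x \<noteq> []"
  shows "distinct (order_around nd xs B)" "set (order_around nd xs B) = set xs"
    "\<And>x y u v. x \<in> set B \<Longrightarrow> y \<in> insert (hd B) (set xs - set B) \<Longrightarrow> u \<in> set (nd x) \<Longrightarrow>
      v \<in> set (nd y) \<Longrightarrow> connects nd (order_around nd xs B) u v"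
proof -
  have B': "B \<noteq> []" "anch nd (rev B)"
    using cl B by (auto simp: clusters_def)
  have dB: "distinct B"
    using cl B by (auto simp: clusters_def distinct_concat_iff)
  define k where "k = hd B"
  have kB: "k \<in> set B" using B'(1) by (simp add: k_def)
  have sub: "set B \<subseteq> set xs" using B set by auto
  define ys where "ys = filter (\<lambda>x. \<forall>y\<in>set B. \<not> same_nodes nd x y) xs"
  have ys: "set ys = set xs - set B"
  proof -
    have "(\<forall>y\<in>set B. \<not> same_nodes nd x y) \<longleftrightarrow> x \<notin> set B" if "x \<in> set xs" for x
      using inj_onD[OF inj _ that] sub unfolding same_nodes_def by blast
    then show ?thesis by (auto simp: ys_def)
  qed
  have ins: "insert k (set ys) = insert (hd B) (set xs - set B)"
    by (simp add: ys k_def)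
  have "insert k (set ys) \<subseteq> set xs"
    using ys kB sub by auto
  note g = grow_spec[of nd k ys, OF
    conn_complement_cluster[OF cl B, unfolded set, folded ins] inj_on_subset[OF inj this]]
  obtain G where G: "rev (grow nd ys k) = k # G"
    using g(3,4) by (metis hd_rev list.collapse rev_is_Nil_conv)
  have ord: "order_around nd xs B = rev B @ G"
    using B'(1) G unfolding order_around_def by (auto simp: k_def ys_def split: list.splits)
  have "distinct (k # G)" "set (k # G) = insert k (set ys)"
    using g(2,5) unfolding G[symmetric] by simp_all
  then have G': "distinct G" "set G = set ys"
    using ys kB by auto
  show "distinct (order_around nd xs B)" "set (order_around nd xs B) = set xs"
    using G' dB ys sub unfolding ord by auto
  fix x y u v
  assume x: "x \<in> set B" "u \<in> set (nd x)" and y: "y \<in> insert (hd B) (set xs - set B)" "v \<in> set (nd y)"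
  \<comment> \<open>\<open>grow\<close> leads towards \<open>k\<close>, so its reversal leads away
    from \<open>k\<close>. As \<open>G\<close> no longer contains \<open>k\<close>, the journey must
    leave from a suitable node of \<open>k\<close>; \<open>rev B\<close> ends with \<open>k\<close>
    and can deliver it to any such node.\<close>
  have "\<exists>w\<in>set (nd k). connects nd G w v"
  proof -
    obtain w where w: "w \<in> set (nd k)"
      using nonempty[of k] kB sub by (cases "nd k") auto
    then have "connects nd (grow nd ys k) v w"
      using connects_to_last[OF g(1), of y v w] g(4,5) y ins by simp
    from connects_rev[OF this] have "connects nd (k # G) w v"
      unfolding G .
    then show ?thesis using w by auto
  qed
  then obtain w where w: "w \<in> set (nd k)" "connects nd G w v" by blast
  have "last (rev B) = k" using B'(1) by (simp add: last_rev k_def)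
  then have "connects nd (rev B) u w"
    using connects_to_last[OF B'(2), of x u w] x w(1) by simp
  then show "connects nd (order_around nd xs B) u v"
    unfolding ord using w(2) by (rule connects_append)
qed


section \<open>Counting the connected pairs\<close>

lemma product_ge_two_ninths:
  fixes n u w :: nat
  assumes "n \<le> 3 * u" "n \<le> u + w" "w = n \<or> 3 * u \<le> 2 * n"
  shows "2 * n\<^sup>2 \<le> 9 * (u * w)"
proof (cases "w = n")
  case True
  have "2 * n\<^sup>2 \<le> 3 * (n * n)" by (simp add: power2_eq_square)
  also have "\<dots> \<le> 3 * (3 * u * n)"
    using assms(1) by (intro mult_left_mono mult_right_mono) auto
  finally show ?thesis using True by (simp add: algebra_simps)
next
  case False
  \<comment> \<open>Expanded, this is 9u(n - u) \<ge> 2n^2; the next fact replaces n - u by w.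
    Working in \<open>int\<close> avoids truncated subtraction.\<close>
  then have "(3 * int u - int n) * (2 * int n - 3 * int u) \<ge> 0"
    using assms(1,3) by (intro mult_nonneg_nonneg) auto
  moreover have "int u * (int u + int w - int n) \<ge> 0"
    using assms(2) by (intro mult_nonneg_nonneg) auto
  ultimately have "2 * (int n)\<^sup>2 \<le> 9 * (int u * int w)"
    by (simp add: algebra_simps power2_eq_square)
  then show ?thesis by (metis (mono_tags) of_nat_le_iff of_nat_mult of_nat_numeral of_nat_power)
qed

lemma trip_order_spec:
  assumes conn: "conn nd (set xs)" and inj: "inj_on (\<lambda>x. set (nd x)) (set xs)"
    and nonempty: "\<And>x. x \<in> set xs \<Longrightarrow> nd x \<noteq> []"
    and vs: "distinct vs" "set vs = (\<Union>x\<in>set xs. set (nd x))"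
  shows "distinct (trip_order nd vs xs)" "set (trip_order nd vs xs) = set xs"
    "2 * (length vs)\<^sup>2 \<le>
       9 * card {(u, v). u \<in> set vs \<and> v \<in> set vs \<and> connects nd (trip_order nd vs xs) u v}"
proof -
  have "distinct (trip_order nd vs xs) \<and> set (trip_order nd vs xs) = set xs \<and>
    2 * (length vs)\<^sup>2 \<le>
       9 * card {(u, v). u \<in> set vs \<and> v \<in> set vs \<and> connects nd (trip_order nd vs xs) u v}"
  proof (cases "xs = []")
    case True
    then show ?thesis using vs by (simp add: trip_order_def carve_def)
  next
    case False
    have all: "\<forall>v\<in>set vs. \<exists>x\<in>set xs. v \<in> set (nd x)"
      using vs(2) by auto
    note cs = carve_spec[OF False conn inj all]
    then obtain B Bs where fil: "filter (large nd vs) (carve nd vs xs) = B # Bs"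
      by (cases "filter (large nd vs) (carve nd vs xs)") (auto simp: filter_empty_conv)
    then have "B \<in> set (filter (large nd vs) (carve nd vs xs))" by simp
    then have B: "B \<in> set (carve nd vs xs)" "large nd vs B" by simp_all
    have ord: "trip_order nd vs xs = order_around nd xs B"
      by (simp add: trip_order_def fil)
    note o = order_around_spec[OF cs(1) B(1) cs(2) inj nonempty]
    have BC: "B \<noteq> []" "length B = 1 \<or> 3 * length (covered nd vs B) \<le> 2 * length vs"
      using cs(1) B(1) by (simp_all add: clusters_def)
    have sub: "set B \<subseteq> set xs" using B(1) cs(2) by auto
    define U where "U = (\<Union>x\<in>set B. set (nd x))"
    \<comment> \<open>The root counts on both sides, which makes \<open>W\<close> the whole node set
      if \<open>B\<close> is a single trip.\<close>
    define W where "W = (\<Union>x\<in>insert (hd B) (set xs - set B). set (nd x))"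
    have hdB: "hd B \<in> set xs" using BC(1) sub by auto
    have UW: "U \<subseteq> set vs" "W \<subseteq> set vs" "set vs \<subseteq> U \<union> W"
      using sub hdB unfolding U_def W_def vs(2) by blast+
    have "set (covered nd vs B) = U"
      using UW(1) by (auto simp: covered_def U_def)
    moreover have "distinct (covered nd vs B)"
      using vs(1) by (simp add: covered_def)
    ultimately have cov: "length (covered nd vs B) = card U"
      by (metis distinct_card)
    have n: "length vs = card (set vs)"
      using vs(1) by (simp add: distinct_card)
    have "card (set vs) \<le> card (U \<union> W)"
      using UW by (intro card_mono) (auto intro: finite_subset)
    also have "\<dots> \<le> card U + card W" by (rule card_Un_le)
    finally have 1: "length vs \<le> card U + card W" by (simp add: n)
    have 2: "card W = length vs \<or> 3 * card U \<le> 2 * length vs"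
    proof (cases "length B = 1")
      case True
      then obtain k where k: "B = [k]" by (cases B) auto
      have "W = set vs"
        unfolding W_def vs(2) using sub by (auto simp: k)
      then show ?thesis by (simp add: n)
    next
      case False
      then show ?thesis using BC(2) cov by simp
    qed
    have "2 * (length vs)\<^sup>2 \<le> 9 * (card U * card W)"
      using product_ge_two_ninths[OF _ 1 2] B(2) cov by (simp add: large_def)
    also have "card U * card W = card (U \<times> W)"
      by (simp add: card_cartesian_product)
    also have "card (U \<times> W) \<le>
        card {(u, v). u \<in> set vs \<and> v \<in> set vs \<and> connects nd (order_around nd xs B) u v}"
    proof (rule card_mono)
      show "finite {(u, v). u \<in> set vs \<and> v \<in> set vs \<and> connects nd (order_around nd xs B) u v}"
        by (rule finite_subset[of _ "set vs \<times> set vs"]) auto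
      show "U \<times> W \<subseteq> {(u, v). u \<in> set vs \<and> v \<in> set vs \<and> connects nd (order_around nd xs B) u v}"
      proof (clarify, intro conjI)
        fix u v assume uv: "u \<in> U" "v \<in> W"
        then show "u \<in> set vs" "v \<in> set vs" using UW by auto
        show "connects nd (order_around nd xs B) u v"
          using uv o(3) unfolding U_def W_def by blast
      qed
    qed
    finally show ?thesis
      using o(1,2) unfolding ord by simp
  qed
  then show "distinct (trip_order nd vs xs)" "set (trip_order nd vs xs) = set xs"
    "2 * (length vs)\<^sup>2 \<le>
       9 * card {(u, v). u \<in> set vs \<and> v \<in> set vs \<and> connects nd (trip_order nd vs xs) u v}"
    by simp_all
qed

section \<open>Trips with equal node sets\<close>

lemma representatives_spec:
  "set (representatives nd xs) \<subseteq> set xs"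
  "inj_on (\<lambda>x. set (nd x)) (set (representatives nd xs))"
  "\<forall>x\<in>set xs. \<exists>r\<in>set (representatives nd xs). same_nodes nd x r"
  unfolding representatives_def
proof (induction xs)
  case (Cons x xs)
  {
    case 1
    then show ?case using Cons(1) by auto
  next
    case 2
    then show ?case using Cons(2) by (auto simp: same_nodes_def)
  next
    case 3
    then show ?case using Cons(3) by (auto simp: same_nodes_def)
  }
qed auto

text \<open>A cut of the representatives lifts to the cut of all trips formed by the classes of
  \<open>P\<close>. A pair crossing it moves back to its representatives, since \<open>meets\<close>
  depends on node sets only.\<close>

lemma conn_representatives:
  assumes "conn nd (set xs)"
  shows "conn nd (set (representatives nd xs))"
  unfolding conn_def
proof (intro allI impI)
  define R where "R = set (representatives nd xs)"
  fix P assume P: "P \<subseteq> set (representatives nd xs)" "P \<noteq> {}" "P \<noteq> set (representatives nd xs)"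
  note r = representatives_spec[where nd = nd and xs = xs, folded R_def]
  have inj: "x = y" if "x \<in> R" "y \<in> R" "set (nd x) = set (nd y)" for x y
    using r(2) that by (auto dest: inj_onD)
  define P' where "P' = {x \<in> set xs. \<exists>p\<in>P. same_nodes nd x p}"
  have PP': "P' \<inter> R = P"
    using P(1) r(1) inj unfolding P'_def same_nodes_def R_def[symmetric] by blast
  have "P' \<subseteq> set xs" "P' \<noteq> {}" "P' \<noteq> set xs"
  proof -
    show "P' \<subseteq> set xs" by (auto simp: P'_def)
    show "P' \<noteq> {}" "P' \<noteq> set xs" using PP' P r(1) unfolding R_def[symmetric] by blast+
  qed
  then obtain x y where xy: "x \<in> P'" "y \<in> set xs - P'" "meets nd x y"
    using assms unfolding conn_def by blast
  obtain p where p: "p \<in> P" "same_nodes nd x p"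
    using xy(1) by (auto simp: P'_def)
  obtain q where q: "q \<in> R" "same_nodes nd y q"
    using r(3) xy(2) by blast
  have "q \<notin> P" using q xy(2) by (auto simp: P'_def)
  moreover have "meets nd p q"
    using xy(3) p(2) q(2) by (simp add: meets_def same_nodes_def)
  ultimately show "\<exists>x\<in>P. \<exists>y\<in>set (representatives nd xs) - P. meets nd x y"
    using p(1) q(1) unfolding R_def by blast
qed

text \<open>Every node set that occurs is represented exactly once in \<open>os\<close>, so each
  trip is listed for exactly one \<open>r\<close>, with its full multiplicity.\<close>

lemma mset_concat_same_nodes:
  assumes "distinct os" "inj_on (\<lambda>x. set (nd x)) (set os)"
    "\<forall>x\<in>set xs. \<exists>r\<in>set os. same_nodes nd x r"
  shows "mset (concat (map (\<lambda>r. filter (same_nodes nd r) xs) os)) = mset xs"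
proof (rule multiset_eqI)
  fix x
  have "count (mset (concat (map (\<lambda>r. filter (same_nodes nd r) xs) os))) x =
      (\<Sum>r\<leftarrow>os. if same_nodes nd r x then count (mset xs) x else 0)"
    by (induction os) auto
  also have "\<dots> = (\<Sum>r\<in>set os. if same_nodes nd r x then count (mset xs) x else 0)"
    using assms(1) by (simp add: sum_list_distinct_conv_sum_set)
  also have "\<dots> = count (mset xs) x"
  proof (cases "x \<in> set xs")
    case True
    then obtain r where r: "r \<in> set os" "same_nodes nd x r" using assms(3) by blast
    have "same_nodes nd r' x \<longleftrightarrow> r' = r" if "r' \<in> set os" for r'
      using inj_onD[OF assms(2) _ that r(1)] r(2) by (auto simp: same_nodes_def)
    then have "(\<Sum>r'\<in>set os. if same_nodes nd r' x then count (mset xs) x else 0) =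
        (\<Sum>r'\<in>set os. if r' = r then count (mset xs) x else 0)"
      by (intro sum.cong) auto
    then show ?thesis using r(1) by simp
  next
    case False
    then have 0: "count (mset xs) x = 0" unfolding count_eq_zero_iff by simp
    show ?thesis unfolding 0 by simp
  qed
  finally show "count (mset (concat (map (\<lambda>r. filter (same_nodes nd r) xs) os))) x =
      count (mset xs) x" .
qed

section \<open>Temporal paths of a schedule\<close>

text \<open>The case \<open>u = v\<close> lets a traveller skip a trip, so \<open>travels\<close>
  can run through every trip of the list.\<close>

definition rides :: "'v list \<Rightarrow> 'v \<Rightarrow> 'v \<Rightarrow> bool" where
  "rides l u v \<longleftrightarrow> u = v \<or> (\<exists>i j. i < j \<and> j < length l \<and> l ! i = u \<and> l ! j = v)"

fun travels :: "('a \<Rightarrow> 'v list) \<Rightarrow> 'a list \<Rightarrow> 'v \<Rightarrow> 'v \<Rightarrow> bool" where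
  "travels nd [] u v \<longleftrightarrow> u = v"
| "travels nd (x # xs) u v \<longleftrightarrow> (\<exists>w. rides (nd x) u w \<and> travels nd xs w v)"

lemma rides_refl: "rides l u u"
  by (simp add: rides_def)

lemma travels_refl: "travels nd xs u u"
  by (induction xs) (auto intro: rides_refl)

lemma travels_append: "travels nd xs u w \<Longrightarrow> travels nd ys w v \<Longrightarrow> travels nd (xs @ ys) u v"
  by (induction xs arbitrary: u) auto

lemma travels_member: "x \<in> set xs \<Longrightarrow> rides (nd x) u v \<Longrightarrow> travels nd xs u v"
proof (induction xs)
  case (Cons y xs)
  then show ?case
    by (cases "x = y") (auto intro: rides_refl travels_refl)
qed simp

text \<open>A step of \<open>connects\<close> through \<open>r\<close> takes a single trip from the
  block of \<open>r\<close> and skips the others, so a block may be scheduled in any order.\<close>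

lemma travels_concat:
  assumes "\<And>r u v. r \<in> set os \<Longrightarrow> u \<in> set (nd r) \<Longrightarrow> v \<in> set (nd r) \<Longrightarrow>
      \<exists>x\<in>set xs. same_nodes nd r x \<and> rides (nd x) u v"
    and "connects nd os u v"
  shows "travels nd (concat (map (\<lambda>r. filter (same_nodes nd r) xs) os)) u v"
  using assms
proof (induction os arbitrary: u)
  case (Cons r os)
  let ?F = "filter (same_nodes nd r) xs" and ?G = "concat (map (\<lambda>r. filter (same_nodes nd r) xs) os)"
  have IH: "travels nd ?G w v" if "connects nd os w v" for w
    using Cons.IH[OF _ that] Cons.prems(1) by simp
  have "\<exists>w. travels nd ?F u w \<and> connects nd os w v"
  proof (cases "connects nd os u v")
    case True
    then show ?thesis by (intro exI[of _ u] conjI travels_refl)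
  next
    case False
    then obtain w where w: "u \<in> set (nd r)" "w \<in> set (nd r)" "connects nd os w v"
      using Cons.prems(2) by auto
    then obtain x where "x \<in> set ?F" "rides (nd x) u w"
      using Cons.prems(1)[of r u w] by auto
    then show ?thesis using w(3) travels_member by metis
  qed
  then show ?case using IH travels_append by fastforce
qed simp

fun schedule_tedges :: "'v trip list \<Rightarrow> real \<Rightarrow> 'v tedge set" where
  "schedule_tedges [] t = {}"
| "schedule_tedges (T # S) t = trip_tedges T t \<union> schedule_tedges S (t + duration T)"

lemma schedule_tedges_conv:
  "schedule_tedges S t = (\<Union>i<length S. trip_tedges (S ! i) (t + (\<Sum>j<i. duration (S ! j))))"
proof (induction S arbitrary: t)
  case (Cons T S)
  have shift: "(\<Sum>j<Suc i. duration ((T # S) ! j)) = duration T + (\<Sum>j<i. duration (S ! j))" for i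
    unfolding sum.lessThan_Suc_shift by simp
  have ins: "{..<length (T # S)} = insert 0 (Suc ` {..<length S})"
    by (simp add: lessThan_Suc_eq_insert_0)
  have "(\<Union>i<length (T # S). trip_tedges ((T # S) ! i) (t + (\<Sum>j<i. duration ((T # S) ! j)))) =
     trip_tedges T t \<union>
       (\<Union>i<length S. trip_tedges (S ! i) (t + duration T + (\<Sum>j<i. duration (S ! j))))"
    unfolding ins UN_insert image_image shift by (simp add: shift add.assoc del: sum.lessThan_Suc)
  then show ?case unfolding schedule_tedges.simps Cons.IH by simp
qed simp

lemma induced_tedges_schedule:
  "induced_tedges (schedule_temporalisation S) = schedule_tedges S 0"
  unfolding induced_tedges_def schedule_temporalisation_def schedule_tedges_conv
  by (auto simp: atLeast0LessThan)

lemma temporal_path_successively: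
  "temporal_path F u p v \<longleftrightarrow> p \<noteq> [] \<and> set p \<subseteq> F \<and> ttail (hd p) = u \<and> thead (last p) = v \<and>
     successively (\<lambda>f g. thead f = ttail g \<and> arrival_time f \<le> start_time g) p"
  unfolding temporal_path_def successively_conv_nth by auto

lemma trip_nodes_nth:
  assumes "walk E T" "i < length T"
  shows "trip_nodes T ! i = tail (T ! i)" "trip_nodes T ! Suc i = head (T ! i)"
proof -
  show "trip_nodes T ! Suc i = head (T ! i)"
    using assms(2) by (simp add: trip_nodes_def)
  show "trip_nodes T ! i = tail (T ! i)"
  proof (cases i)
    case 0
    then show ?thesis using assms by (simp add: trip_nodes_def hd_conv_nth walk_def)
  next
    case (Suc m)
    then show ?thesis using assms by (simp add: trip_nodes_def walk_def)
  qed
qed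

lemma sum_weight_le_duration:
  assumes "\<forall>e\<in>set T. weight e > 0" "i \<le> length T"
  shows "(\<Sum>j<i. weight (T ! j)) \<le> duration T"
proof -
  have "(\<Sum>j<i. weight (T ! j)) \<le> (\<Sum>j<length T. weight (T ! j))"
    using assms by (intro sum_mono2) (auto intro: less_imp_le)
  also have "\<dots> = duration T"
    by (simp add: duration_def sum_list_sum_nth atLeast0LessThan)
  finally show ?thesis .
qed

text \<open>The two time bounds keep the path within the slot of its trip, so that paths in
  successive trips can be concatenated.\<close>

lemma temporal_path_in_trip:
  assumes T: "walk E T" "\<forall>e\<in>set T. weight e > 0" and ij: "i < j" "j \<le> length T"
  shows "\<exists>p. temporal_path (trip_tedges T t) (trip_nodes T ! i) p (trip_nodes T ! j) \<and>
    t \<le> start_time (hd p) \<and> arrival_time (last p) \<le> t + duration T"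
proof -
  define f where
    "f m = (tail (T ! m), head (T ! m), t + (\<Sum>l<m. weight (T ! l)), weight (T ! m))" for m
  \<comment> \<open>From node \<open>i\<close> to node \<open>j\<close> the path takes the edges
    \<open>i\<close> to \<open>j - 1\<close>; \<open>i < j\<close> makes it nonempty.\<close>
  define p where "p = map f [i..<j]"
  have p: "p \<noteq> []" "hd p = f i" "last p = f (j - 1)"
    using ij by (simp_all add: p_def hd_map last_map)
  have "set p \<subseteq> trip_tedges T t"
    using ij(2) by (auto simp: p_def f_def trip_tedges_def)
  moreover have "ttail (hd p) = trip_nodes T ! i"
    using trip_nodes_nth(1)[OF T(1), of i] ij by (simp add: p f_def ttail_def)
  moreover have "thead (last p) = trip_nodes T ! j"
    using trip_nodes_nth(2)[OF T(1), of "j - 1"] ij by (simp add: p f_def thead_def)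
  moreover have "thead (p ! m) = ttail (p ! Suc m) \<and> arrival_time (p ! m) \<le> start_time (p ! Suc m)"
    if "Suc m < length p" for m
    using that ij T(1)
    by (simp add: p_def f_def thead_def ttail_def arrival_time_def start_time_def
        travel_time_def walk_def)
  ultimately have "temporal_path (trip_tedges T t) (trip_nodes T ! i) p (trip_nodes T ! j)"
    using p(1) by (simp add: temporal_path_def)
  moreover have "t \<le> start_time (hd p)"
  proof -
    have "weight (T ! l) \<ge> 0" if "l < i" for l
      using T(2) ij that by (intro less_imp_le) simp
    then have "0 \<le> (\<Sum>l<i. weight (T ! l))" by (intro sum_nonneg) simp
    then show ?thesis by (simp add: p f_def start_time_def)
  qed
  moreover have "arrival_time (last p) = t + (\<Sum>l<Suc (j - 1). weight (T ! l))"
    by (simp add: p f_def arrival_time_def start_time_def travel_time_def)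
  then have "arrival_time (last p) \<le> t + duration T"
    using sum_weight_le_duration[OF T(2), of j] ij by simp
  ultimately show ?thesis by blast
qed

lemma temporal_path_mono: "temporal_path F u p v \<Longrightarrow> F \<subseteq> F' \<Longrightarrow> temporal_path F' u p v"
  unfolding temporal_path_def by blast

text \<open>The case \<open>u = v\<close> stands apart because temporal paths are nonempty. The
  lower bound on the start allows an earlier trip to be put in front.\<close>

lemma travels_temporal_path:
  assumes "\<forall>T\<in>set S. walk E T \<and> (\<forall>e\<in>set T. weight e > 0)" "travels trip_nodes S u v"
  shows "u = v \<or> (\<exists>p. temporal_path (schedule_tedges S t) u p v \<and> t \<le> start_time (hd p))"
  using assms
proof (induction S arbitrary: u t)
  case (Cons T S)
  obtain w where w: "rides (trip_nodes T) u w" "travels trip_nodes S w v"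
    using Cons.prems(2) by auto
  have T: "walk E T" "\<forall>e\<in>set T. weight e > 0" using Cons.prems(1) by auto
  have pos: "duration T \<ge> 0"
    using sum_weight_le_duration[OF T(2), of 0] by simp
  have later: "w = v \<or> (\<exists>p. temporal_path (schedule_tedges S (t + duration T)) w p v \<and>
      t + duration T \<le> start_time (hd p))"
    using Cons.IH[OF _ w(2)] Cons.prems(1) by simp
  show ?case
  proof (cases "u = w")
    case True
    then show ?thesis
      using later pos temporal_path_mono[of "schedule_tedges S (t + duration T)" u _ v
          "schedule_tedges (T # S) t"] by fastforce
  next
    case False
    then obtain i j where "i < j" "j \<le> length T" "trip_nodes T ! i = u" "trip_nodes T ! j = w"
      using w(1) by (auto simp: rides_def trip_nodes_def less_Suc_eq_le)
    then obtain p where p: "temporal_path (trip_tedges T t) u p w" "t \<le> start_time (hd p)"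
      "arrival_time (last p) \<le> t + duration T"
      using temporal_path_in_trip[OF T, of i j t] by auto
    show ?thesis
    proof (cases "w = v")
      case True
      then show ?thesis
        using p temporal_path_mono[OF p(1), of "schedule_tedges (T # S) t"] by auto
    next
      case False
      then obtain q where q: "temporal_path (schedule_tedges S (t + duration T)) w q v"
        "t + duration T \<le> start_time (hd q)"
        using later by blast
      have "temporal_path (schedule_tedges (T # S) t) u (p @ q) v"
        using p q unfolding temporal_path_successively successively_append_iff by auto
      moreover have "hd (p @ q) = hd p"
        using p(1) by (simp add: temporal_path_def)
      ultimately show ?thesis using p(2) by metis
    qed
  qed
qed simp

lemma travels_reachable:
  assumes "\<forall>T\<in>set S. walk E T \<and> (\<forall>e\<in>set T. weight e > 0)" "travels trip_nodes S u v"
  shows "reachable (schedule_temporalisation S) u v"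
  unfolding reachable_def induced_tedges_schedule
  using travels_temporal_path[OF assms, of 0] by blast


text \<open>Agrees with \<open>trip_nodes\<close> except on the empty list, where \<open>trip_nodes\<close> has an unspecified
  head that no program can compute.\<close>

definition visited :: "'v trip \<Rightarrow> 'v list" where
  "visited T = (case T of [] \<Rightarrow> [] | e # _ \<Rightarrow> tail e # map head T)"

lemma visited_eq_trip_nodes: "T \<noteq> [] \<Longrightarrow> visited T = trip_nodes T"
  by (cases T) (auto simp: visited_def trip_nodes_def)

lemma travels_cong: "\<forall>x\<in>set xs. nd x = nd' x \<Longrightarrow> travels nd xs u v \<longleftrightarrow> travels nd' xs u v"
  by (induction xs arbitrary: u) auto

section \<open>Consequences of symmetry and strong temporalisability\<close>

lemma symmetric_trips_reverse:
  assumes "symmetric_trips \<T>" "T \<in># \<T>"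
  obtains T' where "T' \<in># \<T>" "trip_nodes T' = rev (trip_nodes T)"
proof -
  obtain P where P: "image_mset fst P + image_mset snd P = \<T>" "\<forall>(T, T')\<in>#P. is_reverse T T'"
    using assms(1) unfolding symmetric_trips_def by blast
  have "T \<in> fst ` set_mset P \<union> snd ` set_mset P"
    using assms(2) unfolding P(1)[symmetric] by simp
  then consider T' where "(T, T') \<in># P" | T' where "(T', T) \<in># P"
    by auto
  then show thesis
  proof cases
    case 1
    then have "T' \<in> snd ` set_mset P" by (rule image_eqI[rotated]) simp
    then have "T' \<in># \<T>" unfolding P(1)[symmetric] by simp
    moreover have "trip_nodes T' = rev (trip_nodes T)"
      using P(2) 1 by (auto simp: is_reverse_def)
    ultimately show thesis by (rule that)
  next
    case 2
    then have "T' \<in> fst ` set_mset P" by (rule image_eqI[rotated]) simp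
    then have "T' \<in># \<T>" unfolding P(1)[symmetric] by simp
    moreover have "trip_nodes T = rev (trip_nodes T')"
      using P(2) 2 by (auto simp: is_reverse_def)
    then have "trip_nodes T' = rev (trip_nodes T)" by simp
    ultimately show thesis by (rule that)
  qed
qed

text \<open>If \<open>u\<close> occurs before \<open>v\<close> along \<open>T\<close>, then
  \<open>T\<close> itself serves; if after, its reverse does.\<close>

lemma symmetric_trips_rides:
  assumes "symmetric_trips \<T>" "T \<in># \<T>" "u \<in> set (trip_nodes T)" "v \<in> set (trip_nodes T)"
  shows "\<exists>T'\<in>#\<T>. set (trip_nodes T') = set (trip_nodes T) \<and> rides (trip_nodes T') u v"
proof -
  let ?l = "trip_nodes T"
  obtain i j where ij: "i < length ?l" "?l ! i = u" "j < length ?l" "?l ! j = v"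
    using assms(3,4) by (metis in_set_conv_nth)
  obtain T' where T': "T' \<in># \<T>" "trip_nodes T' = rev ?l"
    using symmetric_trips_reverse[OF assms(1,2)] .
  consider "i < j" | "i = j" | "j < i" by linarith
  then show ?thesis
  proof cases
    case 1
    then have "rides ?l u v" using ij by (auto simp: rides_def)
    then show ?thesis using assms(2) by blast
  next
    case 2
    then have "u = v" using ij by simp
    then show ?thesis using assms(2) rides_refl[of ?l u] by auto
  next
    case 3
    have "rides (rev ?l) u v"
      unfolding rides_def
      by (intro disjI2 exI[of _ "length ?l - Suc i"] exI[of _ "length ?l - Suc j"])
         (use 3 ij in \<open>auto simp: rev_nth\<close>)
    then have "rides (trip_nodes T') u v" "set (trip_nodes T') = set ?l"
      using T'(2) by simp_all
    then show ?thesis using T'(1) by blast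
  qed
qed

lemma walk_trip_nodes_edge:
  assumes "walk E T" "i < length T"
  shows "tail (T ! i) \<in> set (trip_nodes T)" "head (T ! i) \<in> set (trip_nodes T)"
proof -
  have "length (trip_nodes T) = Suc (length T)" by (simp add: trip_nodes_def)
  then show "tail (T ! i) \<in> set (trip_nodes T)" "head (T ! i) \<in> set (trip_nodes T)"
    using trip_nodes_nth[OF assms] assms(2) nth_mem[of i "trip_nodes T"] nth_mem[of "Suc i" "trip_nodes T"]
    by simp_all
qed

lemma trip_network_nodes:
  assumes "trip_network V E \<T>"
  shows "V = (\<Union>T\<in>set_mset \<T>. set (trip_nodes T))"
proof -
  have "v \<in> V" if T: "T \<in># \<T>" "v \<in> set (trip_nodes T)" for T v
  proof -
    have "walk E T" using assms T(1) by (simp add: trip_network_def)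
    then have "T \<noteq> []" "set T \<subseteq> set_mset E" by (simp_all add: walk_def)
    moreover have "tail e \<in> V" "head e \<in> V" if "e \<in># E" for e
      using assms that by (simp_all add: trip_network_def multidigraph_def)
    moreover have "v = tail (hd T) \<or> v \<in> head ` set T"
      using T(2) by (simp add: trip_nodes_def)
    ultimately show ?thesis
      using hd_in_set[of T] by blast
  qed
  moreover have "\<forall>v\<in>V. \<exists>T\<in>#\<T>. v \<in> set (trip_nodes T)"
    using assms by (simp add: trip_network_def)
  ultimately show ?thesis by blast
qed

text \<open>A temporal path never leaves the nodes of a family of trips that meets no other trip.\<close>

lemma conn_strongly_temporalisable:
  assumes net: "trip_network V E (mset ts)" and st: "strongly_temporalisable V (mset ts)"
  shows "conn trip_nodes (set ts)"
  unfolding conn_def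
proof (intro allI impI)
  fix P assume P: "P \<subseteq> set ts" "P \<noteq> {}" "P \<noteq> set ts"
  show "\<exists>x\<in>P. \<exists>y\<in>set ts - P. meets trip_nodes x y"
  proof (rule ccontr)
    assume no: "\<not> ?thesis"
    define N where "N = (\<Union>T\<in>P. set (trip_nodes T))"
    have closed: "T \<in> P" if "T \<in> set ts" "v \<in> N" "v \<in> set (trip_nodes T)" for T v
      using no that unfolding N_def meets_def by blast
    obtain x y where xy: "x \<in> P" "y \<in> set ts" "y \<notin> P"
      using P by blast
    define s where "s = tail (hd x)"
    define t where "t = tail (hd y)"
    have s: "s \<in> set (trip_nodes x)" "t \<in> set (trip_nodes y)"
      by (simp_all add: s_def t_def trip_nodes_def)
    have sN: "s \<in> N" using s(1) xy(1) by (auto simp: N_def)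
    have "s \<in> V" "t \<in> V"
      using trip_network_nodes[OF net] s xy P(1) by auto
    then obtain \<tau> where \<tau>: "is_temporalisation (mset ts) \<tau>" "reachable \<tau> s t"
      using st unfolding strongly_temporalisable_def by blast
    have trip: "\<exists>T\<in>set ts. ttail f \<in> set (trip_nodes T) \<and> thead f \<in> set (trip_nodes T)"
      if f: "f \<in> induced_tedges \<tau>" for f
    proof -
      obtain T t' where T: "(T, t') \<in># \<tau>" "f \<in> trip_tedges T t'"
        using f by (auto simp: induced_tedges_def)
      have "T \<in># image_mset fst \<tau>"
        using image_eqI[of T fst "(T, t')" "set_mset \<tau>"] T(1) by simp
      then have Tts: "T \<in> set ts"
        unfolding \<tau>(1)[unfolded is_temporalisation_def] by simp
      then have "walk E T" using net by (simp add: trip_network_def)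
      moreover obtain i where "i < length T" "ttail f = tail (T ! i)" "thead f = head (T ! i)"
        using T(2) by (auto simp: trip_tedges_def ttail_def thead_def)
      ultimately show ?thesis
        using walk_trip_nodes_edge[of E T i] Tts by auto
    qed
    have step: "thead f \<in> N" if f: "f \<in> induced_tedges \<tau>" "ttail f \<in> N" for f
    proof -
      obtain T where T: "T \<in> set ts" "ttail f \<in> set (trip_nodes T)" "thead f \<in> set (trip_nodes T)"
        using trip[OF f(1)] by blast
      from closed[OF T(1) f(2) T(2)] T(3) show ?thesis by (auto simp: N_def)
    qed
    have "t \<in> N"
    proof (cases "s = t")
      case True
      then show ?thesis using sN by simp
    next
      case False
      then obtain p where p: "temporal_path (induced_tedges \<tau>) s p t"
        using \<tau>(2) by (auto simp: reachable_def)
      have p': "p \<noteq> []" "set p \<subseteq> induced_tedges \<tau>" "ttail (hd p) = s" "thead (last p) = t"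
        and link: "\<And>i. Suc i < length p \<Longrightarrow> thead (p ! i) = ttail (p ! Suc i)"
        using p unfolding temporal_path_def by blast+
      have pF: "p ! i \<in> induced_tedges \<tau>" if "i < length p" for i
        using p'(2) nth_mem[OF that] by blast
      have heads: "thead (p ! i) \<in> N" if "i < length p" for i
        using that
      proof (induction i)
        case 0
        have "ttail (p ! 0) = s"
          using p'(1,3) by (simp add: hd_conv_nth)
        then show ?case using step[OF pF[OF 0]] sN by simp
      next
        case (Suc i)
        then show ?case using step[OF pF[OF Suc.prems]] link[OF Suc.prems] by simp
      qed
      have "thead (p ! (length p - 1)) \<in> N"
        by (rule heads) (use p'(1) in simp)
      then show ?thesis
        using p'(1,4) by (simp add: last_conv_nth)
    qed
    then show False using closed[OF xy(2) _ s(2)] xy(3) by blast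
  qed
qed

lemma conn_cong:
  assumes nd: "\<forall>x\<in>X. nd x = nd' x" and conn: "conn nd X"
  shows "conn nd' X"
  unfolding conn_def
proof (intro allI impI)
  fix P assume P: "P \<subseteq> X" "P \<noteq> {}" "P \<noteq> X"
  then obtain x y where xy: "x \<in> P" "y \<in> X - P" "meets nd x y"
    using conn unfolding conn_def by blast
  moreover have "nd x = nd' x" "nd y = nd' y"
    using nd xy P(1) by auto
  ultimately show "\<exists>x\<in>P. \<exists>y\<in>X - P. meets nd' x y"
    unfolding meets_def by auto
qed

lemma hub_schedule_reachability:
  assumes net: "trip_network V E (mset ts)" and sym: "symmetric_trips (mset ts)"
    and st: "strongly_temporalisable V (mset ts)" and vs: "distinct vs" "set vs = V"
  shows "mset (hub_schedule visited vs ts) = mset ts"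
    "2 * (card V)\<^sup>2 \<le> 9 * schedule_reachability V (hub_schedule visited vs ts)"
proof -
  have walk: "walk E T \<and> (\<forall>e\<in>set T. weight e > 0)" if "T \<in> set ts" for T
    using net that by (auto simp: trip_network_def multidigraph_def walk_def)
  then have nd: "visited T = trip_nodes T" "visited T \<noteq> []" if "T \<in> set ts" for T
    using that visited_eq_trip_nodes[of T] by (auto simp: walk_def trip_nodes_def)
  let ?R = "representatives visited ts"
  note r = representatives_spec[where nd = visited and xs = ts]
  have "conn visited (set ts)"
    by (rule conn_cong[OF _ conn_strongly_temporalisable[OF net st]]) (simp add: nd)
  then have conn: "conn visited (set ?R)"
    by (rule conn_representatives)
  have "V = (\<Union>T\<in>set ts. set (visited T))"
    using trip_network_nodes[OF net] nd(1) by simp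
  also have "\<dots> = (\<Union>T\<in>set ?R. set (visited T))"
    using r(1,3) unfolding same_nodes_def by blast
  finally have V: "set vs = (\<Union>T\<in>set ?R. set (visited T))"
    by (simp add: vs)
  have ne: "visited x \<noteq> []" if "x \<in> set ?R" for x
    using nd(2) r(1) that by blast
  note o = trip_order_spec[OF conn r(2) ne vs(1) V]
  define os where "os = trip_order visited vs ?R"
  have S: "hub_schedule visited vs ts = concat (map (\<lambda>r. filter (same_nodes visited r) ts) os)"
    by (simp add: hub_schedule_def os_def)
  show m: "mset (hub_schedule visited vs ts) = mset ts"
    unfolding S by (rule mset_concat_same_nodes) (use o(1,2) r(2,3) in \<open>simp_all add: os_def\<close>)
  have setS: "set (hub_schedule visited vs ts) = set ts"
    using m by (metis set_mset_mset)
  have "reachable (schedule_temporalisation (hub_schedule visited vs ts)) u v"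
    if "connects visited os u v" for u v
  proof (rule travels_reachable)
    show "\<forall>T\<in>set (hub_schedule visited vs ts). walk E T \<and> (\<forall>e\<in>set T. weight e > 0)"
      unfolding setS using walk by blast
    have "travels visited (hub_schedule visited vs ts) u v"
      unfolding S
    proof (rule travels_concat[OF _ that])
      fix T u v assume T: "T \<in> set os" "u \<in> set (visited T)" "v \<in> set (visited T)"
      then have Tts: "T \<in> set ts" using o(2) r(1) by (auto simp: os_def)
      \<comment> \<open>The trip supplied by symmetry has the node set of \<open>T\<close>, hence
        lies in the block of \<open>T\<close>.\<close>
      then obtain T' where "T' \<in> set ts" "set (trip_nodes T') = set (trip_nodes T)"
        "rides (trip_nodes T') u v"
        using symmetric_trips_rides[OF sym, of T u v] T nd(1) by auto
      then show "\<exists>x\<in>set ts. same_nodes visited T x \<and> rides (visited x) u v"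
        using nd(1) Tts by (auto simp: same_nodes_def)
    qed
    then show "travels trip_nodes (hub_schedule visited vs ts) u v"
      using travels_cong[of "hub_schedule visited vs ts" visited trip_nodes] nd(1) setS by simp
  qed
  then have "{(u, v). u \<in> V \<and> v \<in> V \<and> connects visited os u v} \<subseteq> {(u, v). u \<in> V \<and> v \<in> V \<and>
      reachable (schedule_temporalisation (hub_schedule visited vs ts)) u v}"
    by blast
  moreover have "finite {(u, v). u \<in> V \<and> v \<in> V \<and>
      reachable (schedule_temporalisation (hub_schedule visited vs ts)) u v}"
    by (rule finite_subset[of _ "V \<times> V"]) (use vs(2) in auto)
  ultimately have "card {(u, v). u \<in> V \<and> v \<in> V \<and> connects visited os u v} \<le>
      schedule_reachability V (hub_schedule visited vs ts)"
    unfolding schedule_reachability_def reachability_def by (rule card_mono[rotated])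
  moreover have "length vs = card V"
    using vs distinct_card by metis
  ultimately show "2 * (card V)\<^sup>2 \<le> 9 * schedule_reachability V (hub_schedule visited vs ts)"
    using o(3) unfolding os_def[symmetric] vs(2) by simp
qed


section \<open>The schedule is computable in polynomial time\<close>

abbreviation enc_trip :: "(real \<Rightarrow> bintree) \<Rightarrow> nat trip \<Rightarrow> bintree" where
  "enc_trip \<omega> \<equiv> enc_list (enc_edge \<omega>)"

lemma polytime_tail: "polytime ex (enc_edge \<omega>) f \<Longrightarrow> polytime ex enc_nat (\<lambda>x. tail (f x))"
  and polytime_head: "polytime ex (enc_edge \<omega>) f \<Longrightarrow> polytime ex enc_nat (\<lambda>x. head (f x))"
proof -
  assume f: "polytime ex (enc_edge \<omega>) f"
  have "enc_edge \<omega> = enc_prod enc_nat (enc_prod enc_nat \<omega>)"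
    by (simp add: fun_eq_iff enc_edge_def enc_prod_def tail_def head_def weight_def)
  then have "polytime ex (enc_prod enc_nat (enc_prod enc_nat \<omega>)) f" using f by simp
  from polytime_fst[OF this] polytime_fst[OF polytime_snd[OF this]]
  show "polytime ex enc_nat (\<lambda>x. tail (f x))" "polytime ex enc_nat (\<lambda>x. head (f x))"
    unfolding tail_def head_def .
qed

lemma polytime_visited:
  assumes "polytime ex (enc_trip \<omega>) f"
  shows "polytime ex (enc_list enc_nat) (\<lambda>x. visited (f x))"
proof (rule polytime_comp[OF _ assms])
  show "polytime (enc_trip \<omega>) (enc_list enc_nat) visited"
    unfolding visited_def
    by (rule polytime_case_list polytime_map polytime_tail polytime_head polytime_basic)+
qed

lemma polytime_mem:
  assumes "polytime ex enc_nat f" "polytime ex (enc_list enc_nat) g"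
  shows "polytime ex enc_bool (\<lambda>x. f x \<in> set (g x))"
proof -
  have "polytime (enc_prod enc_nat (enc_list enc_nat)) enc_bool (\<lambda>z. \<exists>y\<in>set (snd z). fst z = y)"
    by (rule polytime_bex polytime_eq_nat polytime_basic)+
  from polytime_comp[OF this polytime_Pair[OF assms]] show ?thesis by simp
qed

lemma polytime_meets:
  assumes "polytime ex (enc_trip \<omega>) f" "polytime ex (enc_trip \<omega>) g"
  shows "polytime ex enc_bool (\<lambda>x. meets visited (f x) (g x))"
proof -
  have "polytime (enc_prod (enc_trip \<omega>) (enc_trip \<omega>)) enc_bool
      (\<lambda>z. \<exists>u\<in>set (visited (fst z)). u \<in> set (visited (snd z)))"
    by (rule polytime_bex polytime_mem polytime_visited polytime_basic)+
  from polytime_comp[OF this polytime_Pair[OF assms]] show ?thesis by (simp add: meets_def)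
qed

lemma polytime_same_nodes:
  assumes "polytime ex (enc_trip \<omega>) f" "polytime ex (enc_trip \<omega>) g"
  shows "polytime ex enc_bool (\<lambda>x. same_nodes visited (f x) (g x))"
proof -
  have "polytime (enc_prod (enc_trip \<omega>) (enc_trip \<omega>)) enc_bool
      (\<lambda>z. (\<forall>u\<in>set (visited (fst z)). u \<in> set (visited (snd z))) \<and>
           (\<forall>u\<in>set (visited (snd z)). u \<in> set (visited (fst z))))"
    by (rule polytime_conj polytime_ball polytime_mem polytime_visited polytime_basic)+
  from polytime_comp[OF this polytime_Pair[OF assms]] show ?thesis
    by (rule polytime_cong) (auto simp: same_nodes_def)
qed

lemma polytime_representatives:
  assumes "polytime ex (enc_list (enc_trip \<omega>)) f"
  shows "polytime ex (enc_list (enc_trip \<omega>)) (\<lambda>x. representatives visited (f x))"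
proof (rule polytime_comp[OF _ assms])
  let ?e = "enc_list (enc_trip \<omega>)"
  show "polytime ?e ?e (representatives visited)"
    unfolding representatives_def
  proof (rule polytime_foldr[where b = "[:1, 1:]"])
    show "polytime (enc_prod ?e (enc_prod (enc_trip \<omega>) ?e)) ?e
        (\<lambda>z. if \<exists>y\<in>set (snd (snd z)). same_nodes visited (fst (snd z)) y then snd (snd z)
             else fst (snd z) # snd (snd z))"
      by (rule polytime_bex polytime_same_nodes polytime_basic)+
  qed (auto intro: polytime_id polytime_const)
qed

lemma polytime_extend:
  assumes "polytime ex (enc_list (enc_trip \<omega>)) f" "polytime ex (enc_list (enc_trip \<omega>)) g"
  shows "polytime ex (enc_list (enc_trip \<omega>)) (\<lambda>x. extend visited (f x) (g x))"
proof -
  let ?e = "enc_list (enc_trip \<omega>)"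
  have "polytime (enc_prod ?e ?e) ?e (\<lambda>z. extend visited (fst z) (snd z))"
    unfolding extend_def
  proof (rule polytime_foldr[where b = "[:1, 1:]"])
    show "polytime (enc_prod (enc_prod ?e ?e) (enc_prod (enc_trip \<omega>) ?e)) ?e
        (\<lambda>z. if (\<exists>y\<in>set (snd (snd z)). meets visited (fst (snd z)) y) \<and>
               \<not> (\<exists>y\<in>set (snd (snd z)). same_nodes visited (fst (snd z)) y)
             then fst (snd z) # snd (snd z) else snd (snd z))"
      by (rule polytime_conj polytime_not polytime_bex polytime_same_nodes polytime_meets
          polytime_basic)+
    show "polytime (enc_prod ?e ?e) ?e fst" "polytime (enc_prod ?e ?e) ?e snd"
      by (rule polytime_basic)+
  qed auto
  from polytime_comp[OF this polytime_Pair[OF assms]] show ?thesis by simp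
qed

text \<open>Each element of \<open>xs\<close> is prepended at most once: this is the additive growth
  that the fold in \<open>grow\<close> requires.\<close>

lemma size_extend: "size (enc_list e (extend nd xs a)) \<le> size (enc_list e a) + size (enc_list e xs)"
  by (induction xs) (auto simp: extend_def)

lemma polytime_grow:
  assumes "polytime ex (enc_list (enc_trip \<omega>)) f" "polytime ex (enc_trip \<omega>) g"
  shows "polytime ex (enc_list (enc_trip \<omega>)) (\<lambda>x. grow visited (f x) (g x))"
proof -
  let ?e = "enc_list (enc_trip \<omega>)" and ?ex = "enc_prod (enc_list (enc_trip \<omega>)) (enc_trip \<omega>)"
  have "polytime ?ex ?e (\<lambda>z. grow visited (fst z) (snd z))"
    unfolding grow_def
  proof (rule polytime_foldr[where b = "[:0, 1:]"])
    show "polytime (enc_prod ?ex (enc_prod (enc_trip \<omega>) ?e)) ?e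
        (\<lambda>z. extend visited (fst (fst z)) (snd (snd z)))"
      by (rule polytime_extend polytime_basic)+
    show "size (?e (extend visited (fst x) a)) \<le> size (?e a) +
        poly [:0, 1:] (size (?ex x) + size (enc_trip \<omega> y))" for x y a
      using size_extend[of "enc_trip \<omega>" visited "fst x" a] by (simp add: enc_prod_def)
    show "polytime ?ex ?e fst" "polytime ?ex ?e (\<lambda>z. [snd z])"
      by (rule polytime_basic)+
  qed
  from polytime_comp[OF this polytime_Pair[OF assms]] show ?thesis by simp
qed

lemma polytime_large:
  assumes "polytime ex (enc_list enc_nat) f" "polytime ex (enc_list (enc_trip \<omega>)) g"
  shows "polytime ex enc_bool (\<lambda>x. large visited (f x) (g x))"
proof -
  let ?ex = "enc_prod (enc_list enc_nat) (enc_list (enc_trip \<omega>))"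
  have cov: "polytime ?ex (enc_list enc_nat) (\<lambda>z. covered visited (fst z) (snd z))"
    unfolding covered_def
    by (rule polytime_filter polytime_bex polytime_mem polytime_visited polytime_basic)+
  \<comment> \<open>Concatenating three copies replaces the multiplication by 3, so only lengths of
    lists are compared.\<close>
  have "polytime ?ex enc_bool (\<lambda>z. length (fst z) \<le>
      length (covered visited (fst z) (snd z) @ covered visited (fst z) (snd z) @
        covered visited (fst z) (snd z)))"
    by (rule polytime_length_le polytime_append cov polytime_basic)+
  from polytime_comp[OF this polytime_Pair[OF assms]] show ?thesis
    by (rule polytime_cong) (simp add: large_def, arith)
qed

lemma polytime_roots_meet:
  assumes "polytime ex (enc_list (enc_trip \<omega>)) f" "polytime ex (enc_list (enc_trip \<omega>)) g"
  shows "polytime ex enc_bool (\<lambda>x. roots_meet visited (f x) (g x))"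
proof -
  let ?c = "enc_list (enc_trip \<omega>)"
  have "polytime (enc_prod ?c ?c) enc_bool (\<lambda>z. roots_meet visited (fst z) (snd z))"
    unfolding roots_meet_def by (rule polytime_case_list polytime_meets polytime_basic)+
  from polytime_comp[OF this polytime_Pair[OF assms]] show ?thesis by simp
qed

lemma polytime_absorb:
  assumes "polytime ex (enc_list (enc_trip \<omega>)) f" "polytime ex (enc_list (enc_list (enc_trip \<omega>))) g"
  shows "polytime ex (enc_list (enc_list (enc_trip \<omega>))) (\<lambda>x. absorb visited (f x) (g x))"
proof -
  let ?c = "enc_list (enc_trip \<omega>)"
  let ?ex = "enc_prod ?c (enc_list ?c)"
  have "polytime ?ex ?ex (\<lambda>z. foldr (absorb_step visited) (snd z) (fst z, []))"
  proof (rule polytime_foldr[where b = "[:1, 1:]"])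
    show "polytime (enc_prod ?ex (enc_prod ?c ?ex)) ?ex
        (\<lambda>z. absorb_step visited (fst (snd z)) (snd (snd z)))"
      unfolding absorb_step_def
      by (rule polytime_roots_meet polytime_append polytime_basic)+
    show "size (?ex (absorb_step visited y a)) \<le>
        size (?ex a) + poly [:1, 1:] (size (?ex x) + size (?c y))" for x y a
      by (simp add: absorb_step_def enc_prod_def)
    show "polytime ?ex (enc_list ?c) snd" "polytime ?ex ?ex (\<lambda>z. (fst z, []))"
      by (rule polytime_basic)+
  qed
  then have "polytime ?ex (enc_list ?c) (\<lambda>z. absorb visited (fst z) (snd z))"
    unfolding absorb_def by (rule polytime_snd)
  from polytime_comp[OF this polytime_Pair[OF assms]] show ?thesis by simp
qed

lemma size_absorb:
  "size (enc_list (enc_list e) (absorb nd K Cs)) \<le> size (enc_list e K) + size (enc_list (enc_list e) Cs)"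
proof -
  \<comment> \<open>The pending cluster has to be counted as well, since its size moves to the
    second component when it is merged.\<close>
  have "size (enc_list e (fst (foldr (absorb_step nd) Cs (K, [])))) +
      size (enc_list (enc_list e) (snd (foldr (absorb_step nd) Cs (K, []))))
    \<le> size (enc_list e K) + size (enc_list (enc_list e) Cs)"
    by (induction Cs) (auto simp: absorb_step_def)
  then show ?thesis by (simp add: absorb_def)
qed

text \<open>The entries are only regrouped, so the rounds of \<open>carve\<close> can be iterated
  with growth bound 0.\<close>

lemma size_carve_step:
  "size (enc_list (enc_list e) (carve_step nd vs Cs)) \<le> size (enc_list (enc_list e) Cs)"
proof (cases Cs)
  case (Cons K Cs')
  then show ?thesis
    using size_absorb[of e nd K Cs'] by (simp add: carve_step_def)
qed (simp add: carve_step_def)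

lemma polytime_carve_step:
  assumes "polytime ex (enc_list enc_nat) f" "polytime ex (enc_list (enc_list (enc_trip \<omega>))) g"
  shows "polytime ex (enc_list (enc_list (enc_trip \<omega>))) (\<lambda>x. carve_step visited (f x) (g x))"
proof -
  let ?c = "enc_list (enc_trip \<omega>)"
  have "polytime (enc_prod (enc_list enc_nat) (enc_list ?c)) (enc_list ?c)
      (\<lambda>z. carve_step visited (fst z) (snd z))"
    unfolding carve_step_def
    by (rule polytime_case_list polytime_bex polytime_large polytime_absorb polytime_basic)+
  from polytime_comp[OF this polytime_Pair[OF assms]] show ?thesis by simp
qed

lemma polytime_carve_rounds:
  assumes "polytime ex (enc_list enc_nat) f" "polytime ex (enc_list (enc_trip \<omega>)) g"
    "polytime ex (enc_list (enc_list (enc_trip \<omega>))) h"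
  shows "polytime ex (enc_list (enc_list (enc_trip \<omega>)))
    (\<lambda>x. foldr (\<lambda>_ Cs. carve_step visited (f x) Cs) (g x) (h x))"
proof -
  let ?c = "enc_list (enc_trip \<omega>)"
  let ?ex = "enc_prod (enc_list enc_nat) (enc_prod ?c (enc_list ?c))"
  have "polytime ?ex (enc_list ?c)
      (\<lambda>z. foldr (\<lambda>_ Cs. carve_step visited (fst z) Cs) (fst (snd z)) (snd (snd z)))"
  proof (rule polytime_foldr[where b = 0])
    show "polytime (enc_prod ?ex (enc_prod (enc_trip \<omega>) (enc_list ?c))) (enc_list ?c)
        (\<lambda>z. carve_step visited (fst (fst z)) (snd (snd z)))"
      by (rule polytime_carve_step polytime_basic)+
    show "polytime ?ex ?c (\<lambda>z. fst (snd z))" "polytime ?ex (enc_list ?c) (\<lambda>z. snd (snd z))"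
      by (rule polytime_basic)+
  qed (simp add: size_carve_step)
  from polytime_comp[OF this polytime_Pair[OF assms(1) polytime_Pair[OF assms(2,3)]]]
  show ?thesis by simp
qed

lemma polytime_carve:
  assumes "polytime ex (enc_list enc_nat) f" "polytime ex (enc_list (enc_trip \<omega>)) g"
  shows "polytime ex (enc_list (enc_list (enc_trip \<omega>))) (\<lambda>x. carve visited (f x) (g x))"
proof -
  let ?c = "enc_list (enc_trip \<omega>)"
  have "polytime (enc_prod (enc_list enc_nat) ?c) (enc_list ?c)
      (\<lambda>z. carve visited (fst z) (snd z))"
    unfolding carve_def
    by (rule polytime_case_list polytime_carve_rounds polytime_map polytime_grow polytime_basic)+
  from polytime_comp[OF this polytime_Pair[OF assms]] show ?thesis by simp
qed

lemma polytime_order_around: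
  assumes "polytime ex (enc_list (enc_trip \<omega>)) f" "polytime ex (enc_list (enc_trip \<omega>)) g"
  shows "polytime ex (enc_list (enc_trip \<omega>)) (\<lambda>x. order_around visited (f x) (g x))"
proof -
  let ?c = "enc_list (enc_trip \<omega>)"
  have "polytime (enc_prod ?c ?c) ?c (\<lambda>z. order_around visited (fst z) (snd z))"
    unfolding order_around_def
    by (rule polytime_case_list polytime_append polytime_rev polytime_grow polytime_filter
        polytime_ball polytime_not polytime_same_nodes polytime_basic)+
  from polytime_comp[OF this polytime_Pair[OF assms]] show ?thesis by simp
qed

lemma polytime_trip_order:
  assumes "polytime ex (enc_list enc_nat) f" "polytime ex (enc_list (enc_trip \<omega>)) g"
  shows "polytime ex (enc_list (enc_trip \<omega>)) (\<lambda>x. trip_order visited (f x) (g x))"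
proof -
  let ?c = "enc_list (enc_trip \<omega>)"
  have "polytime (enc_prod (enc_list enc_nat) ?c) ?c (\<lambda>z. trip_order visited (fst z) (snd z))"
    unfolding trip_order_def
    by (rule polytime_case_list polytime_filter polytime_large polytime_carve polytime_order_around
        polytime_basic)+
  from polytime_comp[OF this polytime_Pair[OF assms]] show ?thesis by simp
qed

lemma polytime_hub_schedule:
  "polytime (\<lambda>(vs, es, ts). enc_network \<omega> vs es ts) (enc_trips \<omega>)
     (\<lambda>(vs, es, ts). hub_schedule visited vs ts)"
proof -
  let ?c = "enc_list (enc_trip \<omega>)"
  have "polytime (enc_prod (enc_list enc_nat) (enc_prod (enc_list (enc_edge \<omega>)) ?c)) ?c
      (\<lambda>z. hub_schedule visited (fst z) (snd (snd z)))"
    unfolding hub_schedule_def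
    by (rule polytime_concat polytime_map polytime_filter polytime_same_nodes polytime_trip_order
        polytime_representatives polytime_basic)+
  moreover have "enc_prod (enc_list enc_nat) (enc_prod (enc_list (enc_edge \<omega>)) ?c) =
      (\<lambda>(vs, es, ts). enc_network \<omega> vs es ts)" "?c = enc_trips \<omega>"
    by (auto simp: fun_eq_iff enc_prod_def enc_network_def enc_trips_def)
  ultimately show ?thesis by (simp add: case_prod_unfold)
qed

lemma two_ninths_real: "2 * m\<^sup>2 \<le> 9 * k \<Longrightarrow> real k \<ge> 2 / 9 * (real m)\<^sup>2" for m k :: nat
proof -
  assume "2 * m\<^sup>2 \<le> 9 * k"
  then have "real (2 * m\<^sup>2) \<le> real (9 * k)" by (rule of_nat_mono)
  then show ?thesis by simp
qed

theorem theorem9: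
  shows "(\<forall>(V :: 'v set) E \<T>.
            trip_network V E \<T> \<and> symmetric_trips \<T> \<and> strongly_temporalisable V \<T> \<longrightarrow>
            (\<exists>S. is_schedule \<T> S \<and>
                 real (schedule_reachability V S) \<ge> 2 / 9 * (real (card V))\<^sup>2)) \<and>
         (\<forall>(W :: real set) (\<omega> :: real \<Rightarrow> bintree). inj_on \<omega> W \<longrightarrow>
            (\<exists>(c :: com) (q :: nat poly). \<forall>vs es ts.
               distinct vs \<and> trip_network (set vs) (mset es) (mset ts) \<and> weight ` set es \<subseteq> W \<and>
               symmetric_trips (mset ts) \<and> strongly_temporalisable (set vs) (mset ts) \<longrightarrow>
               (\<exists>S. is_schedule (mset ts) S \<and>
                    real (schedule_reachability (set vs) S) \<ge> 2 / 9 * (real (card (set vs)))\<^sup>2 \<and>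
                    computes_within c (enc_network \<omega> vs es ts) (enc_trips \<omega> S)
                      (poly q (size (enc_network \<omega> vs es ts))))))"
proof (intro conjI allI impI)
  fix V :: "'v set" and E \<T>
  assume net: "trip_network V E \<T> \<and> symmetric_trips \<T> \<and> strongly_temporalisable V \<T>"
  then have "finite V" by (simp add: trip_network_def multidigraph_def)
  then obtain vs where vs: "distinct vs" "set vs = V"
    using finite_distinct_list by metis
  obtain ts where ts: "mset ts = \<T>" using ex_mset by metis
  show "\<exists>S. is_schedule \<T> S \<and> real (schedule_reachability V S) \<ge> 2 / 9 * (real (card V))\<^sup>2"
    using hub_schedule_reachability[of V E ts vs] net vs ts two_ninths_real
    unfolding is_schedule_def by metis
next
  fix W :: "real set" and \<omega> :: "real \<Rightarrow> bintree"
  \<comment> \<open>Uniformity: one program and one polynomial are fixed before any network is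
    given.\<close>
  obtain c q where "\<forall>x. computes_within c ((\<lambda>(vs, es, ts). enc_network \<omega> vs es ts) x)
      (enc_trips \<omega> ((\<lambda>(vs, es, ts). hub_schedule visited vs ts) x))
      (poly q (size ((\<lambda>(vs, es, ts). enc_network \<omega> vs es ts) x)))"
    using computes_within_polytime[OF polytime_hub_schedule] by blast
  then have c: "computes_within c (enc_network \<omega> vs es ts) (enc_trips \<omega> (hub_schedule visited vs ts))
      (poly q (size (enc_network \<omega> vs es ts)))" for vs es ts
    by (metis case_prod_conv)
  have "\<exists>S. is_schedule (mset ts) S \<and>
      real (schedule_reachability (set vs) S) \<ge> 2 / 9 * (real (card (set vs)))\<^sup>2 \<and>
      computes_within c (enc_network \<omega> vs es ts) (enc_trips \<omega> S)
        (poly q (size (enc_network \<omega> vs es ts)))"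
    if "distinct vs" "trip_network (set vs) (mset es) (mset ts)" "symmetric_trips (mset ts)"
      "strongly_temporalisable (set vs) (mset ts)" for vs es ts
    using hub_schedule_reachability[OF that(2,3,4,1) refl] c two_ninths_real
    unfolding is_schedule_def by blast
  then show "\<exists>(c :: com) (q :: nat poly). \<forall>vs es ts.
      distinct vs \<and> trip_network (set vs) (mset es) (mset ts) \<and> weight ` set es \<subseteq> W \<and>
      symmetric_trips (mset ts) \<and> strongly_temporalisable (set vs) (mset ts) \<longrightarrow>
      (\<exists>S. is_schedule (mset ts) S \<and>
           real (schedule_reachability (set vs) S) \<ge> 2 / 9 * (real (card (set vs)))\<^sup>2 \<and>
           computes_within c (enc_network \<omega> vs es ts) (enc_trips \<omega> S)
             (poly q (size (enc_network \<omega> vs es ts))))"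
    by blast
qed

end
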